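(* Let $A$ be a unital semisimple commutative complex Banach algebra and $B$ a unital complex Banach algebra. Let $\mathfrak A$ be an open subgroup of $A^{-1}$ and $\mathfrak B$ an open subgroup of $B^{-1}$, and let $T:\mathfrak A\to\mathfrak B$ be a surjective isometry as a map between metric spaces (i.e. $\|T(f)-T(g)\|=\|f-g\|$ for all $f,g\in\mathfrak A$). Then $B$ is semisimple and commutative, and the map $f\mapsto T(1)^{-1}T(f)$ on $\mathfrak A$ extends to an isometric real algebra isomorphism from $A$ onto $B$ (a surjective real linear, multiplicative, norm-preserving bijection). In particular, $A^{-1}$ is isometrically isomorphic to $B^{-1}$ as a metrizable group.
   Context: $A^{-1}$ and $B^{-1}$ denote the groups of invertible elements of $A$ and $B$ with the metric induced by the norm; $1$ denotes the unit element. *)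

theory Defs
  imports "HOL-Analysis.Analysis"
begin

definition complex_normed_algebra_structure ::
  "(complex \<Rightarrow> 'a::real_normed_algebra_1 \<Rightarrow> 'a) \<Rightarrow> bool" where
  "complex_normed_algebra_structure cs \<longleftrightarrow>
     (\<forall>c x y. cs c (x + y) = cs c x + cs c y) \<and>
     (\<forall>c d x. cs (c + d) x = cs c x + cs d x) \<and>
     (\<forall>c d x. cs (c * d) x = cs c (cs d x)) \<and>
     (\<forall>r x. cs (complex_of_real r) x = r *\<^sub>R x) \<and>
     (\<forall>c x y. cs c (x * y) = cs c x * y) \<and>
     (\<forall>c x y. cs c (x * y) = x * cs c y) \<and>
     (\<forall>c x. norm (cs c x) = cmod c * norm x)"

definition invertibles :: "'a::ring_1 set" where
  "invertibles = {x. \<exists>y. x * y = 1 \<and> y * x = 1}"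

definition ring_inverse :: "'a::ring_1 \<Rightarrow> 'a" where
  "ring_inverse x = (THE y. x * y = 1 \<and> y * x = 1)"

definition open_subgroup_of_invertibles :: "'a::{real_normed_algebra_1} set \<Rightarrow> bool" where
  "open_subgroup_of_invertibles G \<longleftrightarrow>
     G \<subseteq> invertibles \<and> 1 \<in> G \<and>
     (\<forall>x\<in>G. \<forall>y\<in>G. x * y \<in> G) \<and>
     (\<forall>x\<in>G. ring_inverse x \<in> G) \<and>
     openin (top_of_set invertibles) G"

definition left_ideal :: "'a::ring_1 set \<Rightarrow> bool" where
  "left_ideal I \<longleftrightarrow> 0 \<in> I \<and> (\<forall>x\<in>I. \<forall>y\<in>I. x + y \<in> I) \<and> (\<forall>x\<in>I. - x \<in> I)
      \<and> (\<forall>a x. x \<in> I \<longrightarrow> a * x \<in> I)"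

definition maximal_left_ideal :: "'a::ring_1 set \<Rightarrow> bool" where
  "maximal_left_ideal M \<longleftrightarrow> left_ideal M \<and> M \<noteq> UNIV \<and>
     (\<forall>J. left_ideal J \<and> M \<subseteq> J \<and> J \<noteq> UNIV \<longrightarrow> J = M)"

definition jacobson_radical :: "'a::ring_1 set" where
  "jacobson_radical = \<Inter> {M. maximal_left_ideal M}"

definition semisimple :: "'a::ring_1 itself \<Rightarrow> bool" where
  "semisimple _ \<longleftrightarrow> (jacobson_radical :: 'a set) = {0}"

definition commutative_alg :: "'a::ring_1 itself \<Rightarrow> bool" where
  "commutative_alg _ \<longleftrightarrow> (\<forall>x y :: 'a. x * y = y * x)"

end

theory Submission
  imports Defs "HOL-Computational_Algebra.Fundamental_Theorem_Algebra"
begin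

text \<open>
  By a local Mazur--Ulam argument \<open>T\<close> is affine along segments inside its domain, and it extends continuously to \<open>0\<close>; let
  \<open>u\<close> be its value there. On a convex open cone around the positive reals \<open>T - u\<close> agrees with a real linear isometry \<open>S\<close>.
  For an arbitrary \<open>f\<close> in the domain, comparing \<open>T f\<close> with \<open>T (f + c)\<close> for all large complex \<open>c\<close> shows that
  \<open>d = S\<^sup>-\<^sup>1 (T f - u) - f\<close> satisfies \<open>norm (1 + z d) = 1\<close> for all small complex \<open>z\<close>, whence \<open>d = 0\<close> and \<open>T = S + u\<close>.

  An element belongs to the radical iff translation by it preserves an open subgroup of the invertible elements. Hence \<open>S\<close>
  identifies the radicals, \<open>B\<close> is semisimple, and \<open>u\<close>, which lies in the radical of \<open>B\<close>, vanishes.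

  Put \<open>a = S\<^sup>-\<^sup>1 1\<close>. For a character \<open>\<phi>\<close> of \<open>A\<close>, the functional \<open>F = \<phi> (a\<^sup>-\<^sup>1 S\<^sup>-\<^sup>1 _)\<close> is real linear, sends \<open>1\<close> to \<open>1\<close> and
  \<open>i\<close> to \<open>i\<close> or \<open>- i\<close>, and has no zeros on the subgroup of \<open>B\<close>. A real linear version of the Gleason--Kahane--Zelazko theorem
  makes \<open>F\<close> multiplicative, so \<open>a\<^sup>-\<^sup>1 S\<^sup>-\<^sup>1\<close> is a ring isomorphism; it is isometric because \<open>a\<close> and \<open>S 1\<close> have norm \<open>1\<close>.
\<close>

section \<open>A local Mazur--Ulam theorem\<close>

text \<open>The displacement of \<open>z\<close> under isometries of the bounded set
  \<open>D\<close> onto itself is bounded, while a non-zero displacement could be doubled forever.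
  \<open>\<psi>\<close> abstracts the point reflection in \<open>z\<close>.\<close>

lemma reflection_center_fixed:
  fixes D :: "'a::metric_space set"
  assumes z: "z \<in> D" and bd: "bounded D"
    and psiD: "\<And>x. x \<in> D \<Longrightarrow> \<psi> x \<in> D" and invol: "\<And>x. x \<in> D \<Longrightarrow> \<psi> (\<psi> x) = x"
    and psi_iso: "\<And>x y. x \<in> D \<Longrightarrow> y \<in> D \<Longrightarrow> dist (\<psi> x) (\<psi> y) = dist x y"
    and psi_dist: "\<And>x. x \<in> D \<Longrightarrow> dist (\<psi> x) x = 2 * dist x z"
    and onto: "g ` D = D" and iso: "\<And>x y. x \<in> D \<Longrightarrow> y \<in> D \<Longrightarrow> dist (g x) (g y) = dist x y"
  shows "g z = z"
proof -
  define W where "W = {g. g ` D = D \<and> (\<forall>x\<in>D. \<forall>y\<in>D. dist (g x) (g y) = dist x y)}"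
  have psi_z: "\<psi> z = z" using psi_dist[OF z] by simp
  \<comment> \<open>Vaisala's trick: passing from \<open>g\<close> to \<open>\<psi> g\<^sup>-\<^sup>1 \<psi> g\<close> doubles the displacement of \<open>z\<close>.\<close>
  have double: "\<exists>g'\<in>W. dist (g' z) z = 2 * dist (g z) z" if "g \<in> W" for g
  proof -
    have gD: "g ` D = D" and gi: "\<And>x y. x \<in> D \<Longrightarrow> y \<in> D \<Longrightarrow> dist (g x) (g y) = dist x y"
      using that unfolding W_def by auto
    define h where "h = inv_into D g"
    have hD: "h x \<in> D" and gh: "g (h x) = x" if "x \<in> D" for x
      using that gD unfolding h_def by (metis inv_into_into, metis f_inv_into_f)
    have hg: "h (g x) = x" if "x \<in> D" for x
    proof -
      have "g x \<in> D" using gD that by blast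
      then have "dist (h (g x)) x = dist (g (h (g x))) (g x)" using gi hD that by metis
      then show ?thesis using gh[OF \<open>g x \<in> D\<close>] by simp
    qed
    have hi: "dist (h x) (h y) = dist x y" if "x \<in> D" "y \<in> D" for x y
      using gi[of "h x" "h y"] hD gh that by simp
    have gin: "g x \<in> D" if "x \<in> D" for x using gD that by blast
    let ?g = "\<lambda>x. \<psi> (h (\<psi> (g x)))"
    have 1: "dist (?g x) (?g y) = dist x y" if "x \<in> D" "y \<in> D" for x y
      using that by (simp add: psi_iso hi gi hD psiD gin)
    have 2: "?g ` D = D"
    proof
      show "?g ` D \<subseteq> D" using hD psiD gin by auto
      show "D \<subseteq> ?g ` D"
      proof
        fix y assume y: "y \<in> D"
        have "?g (h (\<psi> (g (\<psi> y)))) = y" by (simp add: gh hg y psiD hD gin invol)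
        then show "y \<in> ?g ` D" using y psiD hD gin by (metis imageI)
      qed
    qed
    have "dist (?g z) z = dist (\<psi> (h (\<psi> (g z)))) (\<psi> z)" using psi_z by simp
    also have "\<dots> = dist (h (\<psi> (g z))) z" by (simp add: psi_iso z hD psiD gin)
    also have "\<dots> = dist (h (\<psi> (g z))) (h (g z))" using hg z by simp
    also have "\<dots> = dist (\<psi> (g z)) (g z)" by (simp add: hi z psiD gin)
    also have "\<dots> = 2 * dist (g z) z" by (simp add: psi_dist gin z)
    finally show ?thesis using 1 2 unfolding W_def by (intro bexI[of _ ?g]) auto
  qed
  have "g \<in> W" using onto iso unfolding W_def by auto
  have pow: "\<exists>g'\<in>W. dist (g' z) z = 2 ^ n * dist (g z) z" for n :: nat
  proof (induction n)
    case 0 show ?case using \<open>g \<in> W\<close> by auto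
  next
    case (Suc n)
    then obtain g' where "g' \<in> W" "dist (g' z) z = 2 ^ n * dist (g z) z" by blast
    with double[of g'] show ?case by (auto simp: algebra_simps)
  qed
  obtain K where K: "\<And>x y. x \<in> D \<Longrightarrow> y \<in> D \<Longrightarrow> dist x y \<le> K"
    using bd by (meson bounded_two_points)
  have le: "2 ^ n * dist (g z) z \<le> K" for n :: nat
  proof -
    obtain g' where "g' \<in> W" "dist (g' z) z = 2 ^ n * dist (g z) z" using pow by blast
    moreover have "g' z \<in> D" using \<open>g' \<in> W\<close> z unfolding W_def by blast
    ultimately show ?thesis using K z by metis
  qed
  show ?thesis
  proof (rule ccontr)
    assume "g z \<noteq> z"
    then have p: "dist (g z) z > 0" by simp
    obtain n :: nat where "K / dist (g z) z < 2 ^ n" using real_arch_pow[of 2] by auto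
    then show False using le[of n] p by (simp add: field_simps)
  qed
qed

lemma isometry_midpoint:
  fixes T :: "'a::real_normed_vector \<Rightarrow> 'b::real_normed_vector"
  assumes iso: "\<And>x y. x \<in> U \<Longrightarrow> y \<in> U \<Longrightarrow> dist (T x) (T y) = dist x y"
    and ab: "a \<in> U" "b \<in> U"
    and sub: "cball ((1/2) *\<^sub>R (a + b)) (dist a b / 2) \<subseteq> U"
    and sub': "cball ((1/2) *\<^sub>R (T a + T b)) (dist a b / 2) \<subseteq> T ` U"
  shows "T ((1/2) *\<^sub>R (a + b)) = (1/2) *\<^sub>R (T a + T b)"
proof -
  define r where "r = dist a b / 2"
  define z where "z = (1/2) *\<^sub>R (a + b)"
  define z' where "z' = (1/2) *\<^sub>R (T a + T b)"
  define D where "D = {x. dist x a = r \<and> dist x b = r}"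
  \<comment> \<open>Stated for an arbitrary space because it serves both in the domain and in the
    target.\<close>
  have D_sub: "x \<in> cball ((1/2) *\<^sub>R (c + d)) r" if "dist x c = r" "dist x d = r"
    for x c d :: "'x::real_normed_vector"
  proof -
    have "x - (1/2) *\<^sub>R (c + d) = (1/2) *\<^sub>R ((x - c) + (x - d))"
      by (simp add: algebra_simps flip: scaleR_add_left)
    then have "norm (x - (1/2) *\<^sub>R (c + d)) \<le> (1/2) * (norm (x - c) + norm (x - d))"
      by (simp add: norm_triangle_ineq)
    then show ?thesis using that by (simp add: dist_norm norm_minus_commute)
  qed
  have refl_dist: "dist (c + d - x) x = 2 * dist x ((1/2) *\<^sub>R (c + d))" for x c d :: "'x::real_normed_vector"
  proof -
    have "c + d - x - x = (- 2) *\<^sub>R (x - (1/2) *\<^sub>R (c + d))"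
      by (simp add: algebra_simps scaleR_2)
    then show ?thesis unfolding dist_norm by (simp only: norm_scaleR)
  qed
  have refl: "dist (c + d - x) (c + d - y) = dist x y" for x y c d :: "'x::real_normed_vector"
    by (simp add: dist_norm norm_minus_commute)
  have refl1: "dist (c + d - x) c = dist x d" "dist (c + d - x) d = dist x c" for x c d :: "'x::real_normed_vector"
    by (simp_all add: dist_norm norm_minus_commute algebra_simps)
  have zD: "z \<in> D"
  proof -
    have "z - a = (1/2) *\<^sub>R (b - a)" "z - b = (1/2) *\<^sub>R (a - b)"
      unfolding z_def by (simp_all add: algebra_simps flip: scaleR_add_left)
    then show ?thesis unfolding D_def r_def by (simp add: dist_norm norm_minus_commute)
  qed
  have DU: "x \<in> U" if "x \<in> D" for x using D_sub[of x a b] that sub unfolding D_def r_def by auto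
  have psiD: "a + b - x \<in> D" if "x \<in> D" for x using that unfolding D_def by (simp add: refl1)
  define h where "h = inv_into U T"
  have Th: "T (h y) = y" "h y \<in> U" if "y \<in> T ` U" for y
    using that unfolding h_def by (auto simp: f_inv_into_f inv_into_into)
  have psiT: "T a + T b - T x \<in> T ` U \<and> h (T a + T b - T x) \<in> D" if "x \<in> D" for x
  proof -
    let ?y = "T a + T b - T x"
    have y: "dist ?y (T a) = r" "dist ?y (T b) = r"
      using that iso ab DU[OF that] unfolding D_def by (simp_all add: refl1)
    then have "?y \<in> T ` U" using D_sub[of ?y "T a" "T b"] sub' unfolding r_def by auto
    moreover have "h ?y \<in> D" using y Th[OF \<open>?y \<in> T ` U\<close>] iso ab unfolding D_def by force
    ultimately show ?thesis by blast
  qed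
  let ?g = "\<lambda>x. h (T a + T b - T x)"
  have g_iso: "dist (?g x) (?g y) = dist x y" if "x \<in> D" "y \<in> D" for x y
  proof -
    have "dist (?g x) (?g y) = dist (T (?g x)) (T (?g y))"
      using psiT that DU iso by metis
    also have "\<dots> = dist (T a + T b - T x) (T a + T b - T y)" using psiT that Th by metis
    also have "\<dots> = dist x y" using iso DU that by (simp add: refl)
    finally show ?thesis .
  qed
  have gg: "?g (?g x) = x" if "x \<in> D" for x
  proof -
    have "T (?g x) = T a + T b - T x" using psiT that Th by blast
    then have "?g (?g x) = h (T x)" by simp
    moreover have "dist (h (T x)) x = dist (T (h (T x))) (T x)"
      using iso Th(2)[of "T x"] DU that by auto
    moreover have "T (h (T x)) = T x" using Th DU that by blast
    ultimately show ?thesis by simp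
  qed
  have gD: "?g ` D = D"
  proof
    show "?g ` D \<subseteq> D" using psiT by auto
    show "D \<subseteq> ?g ` D" using gg psiT by (metis (no_types, lifting) image_eqI subsetI)
  qed
  have bdd: "bounded D"
    by (rule bounded_subset[OF bounded_cball[of z r]]) (use D_sub[of _ a b] in \<open>auto simp: D_def z_def\<close>)
  have "?g z = z"
    by (rule reflection_center_fixed[of z D "\<lambda>x. a + b - x" ?g])
       (use zD psiD g_iso gD bdd in \<open>auto simp: refl refl_dist z_def\<close>)
  then have "T z = T a + T b - T z" using psiT[OF zD] Th by metis
  then have "2 *\<^sub>R T z = T a + T b" by (simp add: scaleR_2 algebra_simps)
  then have "T z = (1/2) *\<^sub>R (T a + T b)" by (metis scaleR_scaleR scaleR_one mult.commute nonzero_eq_divide_eq zero_neq_numeral)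
  then show ?thesis by (simp add: z_def)
qed

text \<open>Subdividing the segment makes consecutive points so close that the two balls required above fit into
  \<open>U\<close> and \<open>T ` U\<close>; the images of the subdivision points then have vanishing second differences.\<close>

lemma isometry_midpoint_segment:
  fixes T :: "'a::real_normed_vector \<Rightarrow> 'b::real_normed_vector"
  assumes iso: "\<And>x y. x \<in> U \<Longrightarrow> y \<in> U \<Longrightarrow> dist (T x) (T y) = dist x y"
    and "open U" and "open (T ` U)" and seg: "closed_segment a b \<subseteq> U"
  shows "T ((1/2) *\<^sub>R (a + b)) = (1/2) *\<^sub>R (T a + T b)"
proof -
  have cont: "continuous_on (closed_segment a b) T"
    unfolding continuous_on_iff using iso seg by (metis subsetD)
  obtain e1 where e1: "e1 > 0" "(\<Union>x\<in>closed_segment a b. ball x e1) \<subseteq> U"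
    using compact_subset_open_imp_ball_epsilon_subset[OF compact_segment \<open>open U\<close> seg] by blast
  obtain e2 where e2: "e2 > 0" "(\<Union>x\<in>T ` closed_segment a b. ball x e2) \<subseteq> T ` U"
    using compact_subset_open_imp_ball_epsilon_subset[OF compact_continuous_image[OF cont compact_segment] \<open>open (T ` U)\<close>] seg
    by blast
  define e where "e = min e1 e2"
  have "e > 0" using e1 e2 by (simp add: e_def)
  obtain k :: nat where k: "real k > dist a b / e" using reals_Archimedean2 by blast
  have "0 \<le> dist a b / e" using \<open>e > 0\<close> by simp
  then have k0: "k > 0" using k by (cases k) auto
  \<comment> \<open>An even number of pieces makes \<open>p k\<close> the midpoint of the whole
    segment.\<close>
  define p where "p j = a + (real j / (2 * real k)) *\<^sub>R (b - a)" for j :: nat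
  have p_seg: "p j \<in> closed_segment a b" if "j \<le> 2 * k" for j
  proof -
    have "real j / (2 * real k) \<le> 1" using that k0 by (simp add: field_simps)
    moreover have "p j = (1 - real j / (2 * real k)) *\<^sub>R a + (real j / (2 * real k)) *\<^sub>R b"
      unfolding p_def by (simp add: algebra_simps)
    ultimately show ?thesis unfolding closed_segment_def by (auto intro!: exI[of _ "real j / (2 * real k)"])
  qed
  define h where "h = dist a b / (2 * real k)"
  have h: "2 * h < e" using k \<open>e > 0\<close> k0 unfolding h_def by (simp add: field_simps)
  have h0: "h \<ge> 0" unfolding h_def by simp
  have pd: "dist (p j) (p (j + 2)) = 2 * h" for j
  proof -
    have "real j / (2 * real k) - real (j + 2) / (2 * real k) = - (1 / real k)"
      using k0 by (simp add: field_simps)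
    then have "p j - p (j + 2) = (- (1 / real k)) *\<^sub>R (b - a)"
      unfolding p_def by (metis add_diff_cancel_left scaleR_diff_left)
    then show ?thesis using k0 by (simp add: dist_norm h_def norm_minus_commute)
  qed
  have pm: "(1/2) *\<^sub>R (p j + p (j + 2)) = p (j + 1)" for j
  proof -
    have "(1/2) *\<^sub>R (p j + p (j + 2)) = (1/2) *\<^sub>R (a + a) + (real j / (4 * real k) + real (j + 2) / (4 * real k)) *\<^sub>R (b - a)"
      unfolding p_def scaleR_add_right scaleR_add_left by simp
    also have "real j / (4 * real k) + real (j + 2) / (4 * real k) = real (j + 1) / (2 * real k)"
      using k0 by (simp add: field_simps)
    also have "(1/2) *\<^sub>R (a + a) = a" by (simp add: algebra_simps flip: scaleR_2)
    finally show ?thesis by (simp add: p_def)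
  qed
  have step: "T (p (j + 1)) = (1/2) *\<^sub>R (T (p j) + T (p (j + 2)))" if "j + 2 \<le> 2 * k" for j
  proof -
    have mem: "p j \<in> U" "p (j + 2) \<in> U" using p_seg seg that by (meson add_leD1 subsetD)+
    have "cball (p (j + 1)) h \<subseteq> ball (p (j + 1)) e1" using h h0 \<open>e > 0\<close> by (auto simp: e_def)
    also have "\<dots> \<subseteq> U" using e1 p_seg[of "j + 1"] that by auto
    finally have 1: "cball ((1/2) *\<^sub>R (p j + p (j + 2))) (dist (p j) (p (j + 2)) / 2) \<subseteq> U"
      unfolding pm pd by simp
    have td: "dist (T (p j)) (T (p (j + 2))) = 2 * h" using iso mem pd by simp
    have "T (p j) - (1/2) *\<^sub>R (T (p j) + T (p (j + 2))) = (1/2) *\<^sub>R (T (p j) - T (p (j + 2)))"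
      by (simp add: algebra_simps flip: scaleR_add_left)
    then have tm: "dist (T (p j)) ((1/2) *\<^sub>R (T (p j) + T (p (j + 2)))) = h"
      using td by (simp add: dist_norm)
    have "cball ((1/2) *\<^sub>R (T (p j) + T (p (j + 2)))) h \<subseteq> ball (T (p j)) e2"
    proof
      fix y assume "y \<in> cball ((1/2) *\<^sub>R (T (p j) + T (p (j + 2)))) h"
      then have "dist (T (p j)) y \<le> h + h" using tm
        by (smt (verit) dist_triangle mem_cball)
      then show "y \<in> ball (T (p j)) e2" using h by (simp add: e_def)
    qed
    also have "\<dots> \<subseteq> T ` U" using e2 p_seg[of j] that by auto
    finally have 2: "cball ((1/2) *\<^sub>R (T (p j) + T (p (j + 2)))) (dist (p j) (p (j + 2)) / 2) \<subseteq> T ` U"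
      unfolding pd by simp
    show ?thesis using isometry_midpoint[OF iso mem 1 2] unfolding pm by simp
  qed
  have lin: "T (p j) = T (p 0) + real j *\<^sub>R (T (p 1) - T (p 0)) \<and>
     T (p (j + 1)) = T (p 0) + real (j + 1) *\<^sub>R (T (p 1) - T (p 0))" if "j + 1 \<le> 2 * k" for j
    using that
  proof (induction j)
    case 0 show ?case by simp
  next
    case (Suc j)
    define d where "d = T (p 1) - T (p 0)"
    have IH: "T (p j) = T (p 0) + real j *\<^sub>R d" "T (p (j + 1)) = T (p 0) + real (j + 1) *\<^sub>R d"
      using Suc unfolding d_def by simp_all
    have "2 *\<^sub>R T (p (j + 1)) = T (p j) + T (p (j + 2))" using step[of j] Suc.prems by simp
    then have "T (p (j + 2)) = 2 *\<^sub>R T (p (j + 1)) - T (p j)" by simp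
    also have "\<dots> = T (p 0) + real (j + 2) *\<^sub>R d"
      unfolding IH by (simp add: algebra_simps scaleR_2) (simp flip: scaleR_add_left)
    finally show ?case using IH(2) by (simp add: d_def)
  qed
  define d where "d = T (p 1) - T (p 0)"
  have "T (p k) = T (p 0) + real k *\<^sub>R d" using lin[of k] k0 by (simp add: d_def)
  moreover have "T (p (2 * k)) = T (p 0) + real (2 * k) *\<^sub>R d"
    using lin[of "2 * k - 1"] k0 by (simp add: d_def)
  ultimately have "(1/2) *\<^sub>R (T (p 0) + T (p (2 * k))) = T (p k)"
    by (simp add: algebra_simps) (simp flip: scaleR_add_left)
  moreover have "p 0 = a" "p (2 * k) = b" "p k = (1/2) *\<^sub>R (a + b)"
    unfolding p_def using k0 by (simp_all add: algebra_simps flip: scaleR_add_left)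
  ultimately show ?thesis by simp
qed

section \<open>Open subgroups of the invertible elements and the radical\<close>

lemma invertiblesI: "x * y = 1 \<Longrightarrow> y * x = 1 \<Longrightarrow> x \<in> invertibles"
  unfolding invertibles_def by blast

lemma ring_inverse_unique:
  fixes x :: "'a::ring_1"
  assumes "x * y = 1" "y * x = 1"
  shows "ring_inverse x = y"
  unfolding ring_inverse_def
proof (rule the_equality)
  show "x * y = 1 \<and> y * x = 1" using assms by simp
  show "z = y" if "x * z = 1 \<and> z * x = 1" for z
    using assms that by (metis mult.assoc mult.left_neutral mult.right_neutral)
qed

lemma ring_inverse_right: "x \<in> invertibles \<Longrightarrow> x * ring_inverse x = 1"
  and ring_inverse_left: "x \<in> invertibles \<Longrightarrow> ring_inverse x * x = 1"
  unfolding invertibles_def using ring_inverse_unique by fastforce+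

lemma ring_inverse_right_assoc: "x \<in> invertibles \<Longrightarrow> x * (ring_inverse x * y) = y"
  and ring_inverse_left_assoc: "x \<in> invertibles \<Longrightarrow> ring_inverse x * (x * y) = y"
  by (metis mult.assoc mult.left_neutral ring_inverse_right, metis mult.assoc mult.left_neutral ring_inverse_left)

lemma invertibles_mult:
  assumes "x \<in> invertibles" "y \<in> invertibles"
  shows "x * y \<in> invertibles"
proof (rule invertiblesI)
  show "x * y * (ring_inverse y * ring_inverse x) = 1"
    using assms by (simp add: mult.assoc ring_inverse_right_assoc ring_inverse_right)
  show "ring_inverse y * ring_inverse x * (x * y) = 1"
    using assms by (simp add: mult.assoc ring_inverse_left_assoc ring_inverse_left)
qed

text \<open>Neumann series.\<close>

lemma one_minus_invertible:
  fixes x :: "'a::{real_normed_algebra_1, banach}"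
  assumes "norm x < 1"
  shows "1 - x \<in> invertibles"
proof (rule invertiblesI)
  have sm: "summable (\<lambda>n. x ^ n)"
    by (rule summable_norm_cancel, rule summable_comparison_test'[of "\<lambda>n. norm x ^ n" 0])
       (use assms in \<open>auto simp: norm_power_ineq summable_geometric\<close>)
  have "(\<Sum>n. x ^ Suc n) = (\<Sum>n. x ^ n) - 1" using suminf_split_head[OF sm] by simp
  moreover have "x * (\<Sum>n. x ^ n) = (\<Sum>n. x ^ Suc n)" using suminf_mult[OF sm, of x] by simp
  moreover have "(\<Sum>n. x ^ n) * x = (\<Sum>n. x ^ Suc n)"
    using suminf_mult2[OF sm, of x] by (simp add: power_commutes)
  ultimately show "(1 - x) * (\<Sum>n. x ^ n) = 1" "(\<Sum>n. x ^ n) * (1 - x) = 1"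
    by (simp_all add: algebra_simps)
qed

lemma open_invertibles: "open (invertibles :: 'a::{real_normed_algebra_1, banach} set)"
  unfolding open_dist
proof
  fix x :: 'a assume x: "x \<in> invertibles"
  let ?i = "ring_inverse x"
  have "?i \<noteq> 0" using ring_inverse_left[OF x] by auto
  have "y \<in> invertibles" if "dist y x < 1 / norm ?i" for y
  proof -
    have "norm (?i * (x - y)) \<le> norm ?i * norm (x - y)" by (rule norm_mult_ineq)
    also have "\<dots> < 1" using that \<open>?i \<noteq> 0\<close> by (simp add: dist_norm norm_minus_commute field_simps)
    finally have "x * (1 - ?i * (x - y)) \<in> invertibles"
      using one_minus_invertible invertibles_mult x by blast
    moreover have "x * (1 - ?i * (x - y)) = y"
      using x by (simp add: algebra_simps ring_inverse_right_assoc ring_inverse_right)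
    ultimately show ?thesis by simp
  qed
  then show "\<exists>e>0. \<forall>y. dist y x < e \<longrightarrow> y \<in> invertibles"
    using \<open>?i \<noteq> 0\<close> by (intro exI[of _ "1 / norm ?i"]) auto
qed

lemma open_subgroupD:
  fixes G :: "'a::{real_normed_algebra_1, banach} set"
  assumes "open_subgroup_of_invertibles G"
  shows open_subgroup_invertible: "x \<in> G \<Longrightarrow> x \<in> invertibles"
    and open_subgroup_one: "1 \<in> G"
    and open_subgroup_mult: "x \<in> G \<Longrightarrow> y \<in> G \<Longrightarrow> x * y \<in> G"
    and open_subgroup_inverse: "x \<in> G \<Longrightarrow> ring_inverse x \<in> G"
    and open_subgroup_open: "open G"
proof -
  note a = assms[unfolded open_subgroup_of_invertibles_def]
  show "x \<in> G \<Longrightarrow> x \<in> invertibles" using a by blast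
  show "1 \<in> G" using a by blast
  show "x \<in> G \<Longrightarrow> y \<in> G \<Longrightarrow> x * y \<in> G" using a by blast
  show "x \<in> G \<Longrightarrow> ring_inverse x \<in> G" using a by blast
  show "open G" using a openin_open_eq[OF open_invertibles] by blast
qed

text \<open>Cosets of an open subgroup are open, so membership in \<open>G\<close> is locally
  constant along a path of invertible elements.\<close>

lemma open_subgroup_path:
  fixes p :: "real \<Rightarrow> 'a::{real_normed_algebra_1, banach}"
  assumes G: "open_subgroup_of_invertibles G"
    and cont: "continuous_on {0..1} p" and inv: "\<And>t. t \<in> {0..1} \<Longrightarrow> p t \<in> invertibles"
    and "p 0 \<in> G"
  shows "p 1 \<in> G"
proof (rule connected_induction_simple[of "{0..1::real}" 0 1 "\<lambda>t. p t \<in> G"])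
  fix a :: real assume a: "a \<in> {0..1}"
  define q where "q t = ring_inverse (p a) * p t" for t
  have q: "p t = p a * q t" for t
    unfolding q_def using inv[OF a] by (simp add: ring_inverse_right_assoc)
  \<comment> \<open>The parameters whose point lies in the coset of \<open>p a\<close>; if one of
    these points is in \<open>G\<close>, so is \<open>p a\<close>, and then all are.\<close>
  define N where "N = {0..1} \<inter> q -` G"
  have "openin (top_of_set {0..1}) N"
    unfolding N_def q_def
    by (rule continuous_openin_preimage_gen) (auto intro!: continuous_intros cont open_subgroup_open[OF G])
  moreover have "a \<in> N"
    using a inv[OF a] open_subgroup_one[OF G] by (simp add: N_def q_def ring_inverse_left)
  moreover have "p y \<in> G" if "x \<in> N" "y \<in> N" "p x \<in> G" for x y
  proof -
    have qx: "q x \<in> G" "q y \<in> G" using that by (auto simp: N_def)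
    have "p a = p x * ring_inverse (q x)"
      using q[of x] ring_inverse_right[OF open_subgroup_invertible[OF G qx(1)]] by (simp add: mult.assoc)
    then have "p a \<in> G" using qx that open_subgroup_mult[OF G] open_subgroup_inverse[OF G] by metis
    then show ?thesis using q[of y] qx open_subgroup_mult[OF G] by metis
  qed
  ultimately show "\<exists>T. openin (top_of_set {0..1}) T \<and> a \<in> T \<and> (\<forall>x\<in>T. \<forall>y\<in>T. p x \<in> G \<longrightarrow> p y \<in> G)"
    by blast
qed (use assms in auto)

lemma one_minus_in_open_subgroup:
  fixes G :: "'a::{real_normed_algebra_1, banach} set"
  assumes G: "open_subgroup_of_invertibles G" and "norm x < 1"
  shows "1 - x \<in> G"
proof -
  have "1 - t *\<^sub>R x \<in> invertibles" if "t \<in> {0..1}" for t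
  proof (rule one_minus_invertible)
    have "\<bar>t\<bar> * norm x \<le> 1 * norm x" using that by (intro mult_right_mono) auto
    then show "norm (t *\<^sub>R x) < 1" using assms by simp
  qed
  then have "1 - (1::real) *\<^sub>R x \<in> G"
    using open_subgroup_one[OF G]
    by (intro open_subgroup_path[OF G, of "\<lambda>t. 1 - t *\<^sub>R x"]) (auto intro!: continuous_intros)
  then show ?thesis by simp
qed

section \<open>Maximal left ideals and the Jacobson radical\<close>

lemma left_ideal_subset_maximal:
  fixes I :: "'a::ring_1 set"
  assumes I: "left_ideal I" "1 \<notin> I"
  shows "\<exists>M. maximal_left_ideal M \<and> I \<subseteq> M"
proof -
  \<comment> \<open>Properness is expressed as \<open>1 \<notin> J\<close>, a condition that passes
    to unions of chains.\<close>
  define P where "P = {J :: 'a set. left_ideal J \<and> 1 \<notin> J \<and> I \<subseteq> J}"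
  have "\<exists>M\<in>P. \<forall>X\<in>P. M \<subseteq> X \<longrightarrow> X = M"
  proof (rule subset_Zorn_nonempty)
    show "P \<noteq> {}" using I unfolding P_def by auto
    fix C assume C: "C \<noteq> {}" "subset.chain P C"
    then have CP: "C \<subseteq> P" and tot: "\<And>X Y. X \<in> C \<Longrightarrow> Y \<in> C \<Longrightarrow> X \<subseteq> Y \<or> Y \<subseteq> X"
      unfolding subset.chain_def by auto
    have 0: "0 \<in> J" and 2: "\<And>x. x \<in> J \<Longrightarrow> - x \<in> J" and 3: "\<And>a x. x \<in> J \<Longrightarrow> a * x \<in> J"
      and 4: "1 \<notin> J" and 5: "I \<subseteq> J" and 6: "\<And>x y. x \<in> J \<Longrightarrow> y \<in> J \<Longrightarrow> x + y \<in> J" if "J \<in> C" for J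
      using that CP unfolding P_def left_ideal_def by auto
    have "x + y \<in> \<Union>C" if xy: "x \<in> \<Union>C" "y \<in> \<Union>C" for x y
    proof -
      obtain X where X: "X \<in> C" "x \<in> X" using xy(1) by blast
      obtain Y where Y: "Y \<in> C" "y \<in> Y" using xy(2) by blast
      note XY = X Y
      from tot[OF XY(1,3)] show ?thesis using 6 XY by (metis UnionI subsetD)
    qed
    moreover have "0 \<in> \<Union>C" "I \<subseteq> \<Union>C" "1 \<notin> \<Union>C" using C 0 4 5 by blast+
    moreover have "- x \<in> \<Union>C" "a * x \<in> \<Union>C" if "x \<in> \<Union>C" for a x using that 2 3 by blast+
    ultimately show "\<Union>C \<in> P" unfolding P_def left_ideal_def by blast
  qed
  then obtain M where M: "M \<in> P" "\<And>X. X \<in> P \<Longrightarrow> M \<subseteq> X \<Longrightarrow> X = M" by blast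
  have "J = M" if "left_ideal J" "M \<subseteq> J" "J \<noteq> UNIV" for J
  proof -
    have "1 \<notin> J"
    proof
      assume "1 \<in> J"
      then have "a \<in> J" for a using \<open>left_ideal J\<close> unfolding left_ideal_def by (metis mult.right_neutral)
      then show False using that by auto
    qed
    then show ?thesis using M that unfolding P_def by blast
  qed
  then show ?thesis using M unfolding P_def maximal_left_ideal_def by blast
qed

lemma maximal_left_ideal_one: "maximal_left_ideal M \<Longrightarrow> 1 \<notin> M"
  unfolding maximal_left_ideal_def left_ideal_def by (metis UNIV_eq_I mult.right_neutral)

lemma left_ideal_jacobson_radical: "left_ideal jacobson_radical"
  unfolding jacobson_radical_def maximal_left_ideal_def left_ideal_def by simp

text \<open>The left ideal generated by \<open>M\<close> and \<open>x\<close> is everything, hence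
  contains \<open>1\<close>.\<close>

lemma maximal_left_ideal_left_inverse:
  fixes M :: "'a::ring_1 set"
  assumes M: "maximal_left_ideal M" and x: "x \<notin> M"
  shows "\<exists>y. y * x - 1 \<in> M"
proof -
  have LM: "left_ideal M" using M unfolding maximal_left_ideal_def by blast
  note M' = LM[unfolded left_ideal_def]
  define J where "J = {m + a * x | m a. m \<in> M}"
  have 1: "m + a * x + (n + b * x) = (m + n) + (a + b) * x" "- (m + a * x) = - m + (- a) * x"
    "c * (m + a * x) = c * m + (c * a) * x" for m a n b c
    by (simp_all add: algebra_simps)
  have "left_ideal J"
    unfolding left_ideal_def
  proof (intro conjI ballI allI impI)
    show "0 \<in> J" unfolding J_def using M' by (intro CollectI exI[of _ 0]) auto
    show "u + v \<in> J" if "u \<in> J" "v \<in> J" for u v using that M' 1(1) unfolding J_def by blast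
    show "- u \<in> J" if "u \<in> J" for u using that M' 1(2) unfolding J_def by blast
    show "c * u \<in> J" if "u \<in> J" for c u using that M' 1(3) unfolding J_def by blast
  qed
  moreover have "M \<subseteq> J" unfolding J_def by (force intro: exI[of _ "0::'a"])
  moreover have "x \<in> J" unfolding J_def using M' by (intro CollectI exI[of _ 0] exI[of _ 1]) auto
  ultimately have "J = UNIV" using M x unfolding maximal_left_ideal_def by blast
  then obtain m a where "m \<in> M" "1 = m + a * x" unfolding J_def by blast
  then have "a * x - 1 = - m" by (simp add: algebra_simps)
  then show ?thesis using M' \<open>m \<in> M\<close> by metis
qed

lemma jacobson_radical_one_plus:
  fixes x :: "'a::ring_1"
  assumes "x \<in> jacobson_radical"
  shows "1 + x \<in> invertibles"
proof -
  have left_inv: "\<exists>a. a * (1 + y) = 1" if y: "y \<in> jacobson_radical" for y :: 'a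
  proof (rule ccontr)
    assume no: "\<not> ?thesis"
    define I where "I = range (\<lambda>a. a * (1 + y))"
    have 1: "a * (1 + y) + b * (1 + y) = (a + b) * (1 + y)" "- (a * (1 + y)) = (- a) * (1 + y)"
      "c * (a * (1 + y)) = (c * a) * (1 + y)" "0 = 0 * (1 + y)" for a b c
      by (simp_all add: algebra_simps)
    have "left_ideal I"
      unfolding left_ideal_def
    proof (intro conjI ballI allI impI)
      show "0 \<in> I" unfolding I_def using 1(4) by (rule range_eqI)
      show "u + v \<in> I" if uv: "u \<in> I" "v \<in> I" for u v
        using uv unfolding I_def by (elim rangeE) (simp only: 1(1), rule rangeI)
      show "- u \<in> I" if u: "u \<in> I" for u
        using u unfolding I_def by (elim rangeE) (simp only: 1(2), rule rangeI)
      show "c * u \<in> I" if u: "u \<in> I" for c u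
        using u unfolding I_def by (elim rangeE) (simp only: 1(3), rule rangeI)
    qed
    moreover have "1 \<notin> I" using no unfolding I_def by (metis imageE)
    ultimately obtain M where M: "maximal_left_ideal M" "I \<subseteq> M" using left_ideal_subset_maximal by blast
    have LM: "left_ideal M" using M unfolding maximal_left_ideal_def by blast
    have "1 * (1 + y) \<in> M" using M unfolding I_def by blast
    moreover have "- y \<in> M" using y M LM unfolding jacobson_radical_def left_ideal_def by blast
    ultimately have "1 * (1 + y) + - y \<in> M" using LM unfolding left_ideal_def by blast
    then show False using maximal_left_ideal_one[OF M(1)] by simp
  qed
  obtain a where a: "a * (1 + x) = 1" using left_inv assms by blast
  \<comment> \<open>The left inverse \<open>a\<close> is again \<open>1\<close> plus an element of
    the radical, so it has a left inverse itself, which makes \<open>a\<close> a two-sided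
    inverse.\<close>
  then have "a = 1 + (- (a * x))" by (simp add: algebra_simps)
  moreover have "- (a * x) \<in> jacobson_radical"
    using assms left_ideal_jacobson_radical unfolding left_ideal_def by blast
  ultimately obtain b where b: "b * a = 1" using left_inv by metis
  have "b = b * (a * (1 + x))" using a by simp
  also have "\<dots> = 1 + x" using b by (simp flip: mult.assoc)
  finally show ?thesis using a b by (intro invertiblesI[of _ a]) auto
qed

text \<open>If \<open>u\<close> were outside a maximal \<open>M\<close>, then
  \<open>y * u - 1\<close> would lie in \<open>M\<close> for some \<open>y\<close>; but this element
  has a left inverse by the hypothesis for \<open>a = - y\<close>.\<close>

lemma jacobson_radicalI:
  fixes u :: "'a::ring_1"
  assumes "\<And>a. \<exists>b. b * (1 + a * u) = 1"
  shows "u \<in> jacobson_radical"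
  unfolding jacobson_radical_def
proof (intro InterI, clarsimp)
  fix M :: "'a set" assume M: "maximal_left_ideal M"
  then have LM: "left_ideal M" unfolding maximal_left_ideal_def by blast
  show "u \<in> M"
  proof (rule ccontr)
    assume "u \<notin> M"
    then obtain y where y: "y * u - 1 \<in> M" using maximal_left_ideal_left_inverse M by blast
    obtain b where "b * (1 + (- y) * u) = 1" using assms by blast
    then have "1 = (- b) * (y * u - 1)" by (simp add: algebra_simps)
    then have "1 \<in> M" using y LM unfolding left_ideal_def by metis
    then show False using maximal_left_ideal_one M by blast
  qed
qed

text \<open>The segment from \<open>g\<close> to \<open>g + v\<close> stays invertible, because
  \<open>g + t v = g (1 + t g\<^sup>-\<^sup>1 v)\<close>.\<close>

lemma open_subgroup_add_jacobson_radical: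
  fixes G :: "'a::{real_normed_algebra_1, banach} set"
  assumes G: "open_subgroup_of_invertibles G" and g: "g \<in> G" and v: "v \<in> jacobson_radical"
  shows "g + v \<in> G"
proof -
  have gi: "g \<in> invertibles" using G g open_subgroup_invertible by blast
  have "g + t *\<^sub>R v \<in> invertibles" for t
  proof -
    have "(t *\<^sub>R ring_inverse g) * v \<in> jacobson_radical"
      using v left_ideal_jacobson_radical unfolding left_ideal_def by blast
    then have "g * (1 + (t *\<^sub>R ring_inverse g) * v) \<in> invertibles"
      using gi jacobson_radical_one_plus invertibles_mult by blast
    then show ?thesis using gi by (simp add: algebra_simps ring_inverse_right_assoc)
  qed
  then have "g + (1::real) *\<^sub>R v \<in> G"
    using g by (intro open_subgroup_path[OF G, of "\<lambda>t. g + t *\<^sub>R v"]) (auto intro!: continuous_intros)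
  then show ?thesis by simp
qed

section \<open>Complex scalars as central elements of the algebra\<close>

locale complex_algebra =
  fixes cs :: "complex \<Rightarrow> 'a::{real_normed_algebra_1, banach} \<Rightarrow> 'a"
  assumes alg_structure: "complex_normed_algebra_structure cs"
begin

definition emb :: "complex \<Rightarrow> 'a" where "emb c = cs c 1"

lemma emb_add: "emb (c + d) = emb c + emb d"
  and emb_mult: "emb (c * d) = emb c * emb d"
  and emb_of_real: "emb (complex_of_real r) = of_real r"
  and emb_commutes: "emb c * x = x * emb c"
  and norm_emb_mult: "norm (emb c * x) = cmod c * norm x"
proof -
  note s = alg_structure[unfolded complex_normed_algebra_structure_def]
  have s1: "cs (c + d) x = cs c x + cs d x" and s2: "cs (c * d) x = cs c (cs d x)"
    and s3: "cs (complex_of_real r) x = r *\<^sub>R x" and s4: "cs c (x * y) = cs c x * y"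
    and s5: "cs c (x * y) = x * cs c y" and s6: "norm (cs c x) = cmod c * norm x"
    for c d r x y using s by blast+
  have cs: "cs c x = emb c * x" for c x using s4[of c 1 x] by (simp add: emb_def)
  show "emb (c + d) = emb c + emb d" unfolding emb_def by (rule s1)
  show "emb (c * d) = emb c * emb d" using s2[of c d 1] cs[of c "emb d"] by (simp add: emb_def)
  show "emb (complex_of_real r) = of_real r" using s3[of r 1] by (simp add: emb_def of_real_def)
  show "emb c * x = x * emb c" using s5[of c x 1] cs[of c x] by (simp add: emb_def)
  show "norm (emb c * x) = cmod c * norm x" using s6[of c x] cs[of c x] by simp
qed

lemma emb_0 [simp]: "emb 0 = 0" using emb_of_real[of 0] by simp
lemma emb_1 [simp]: "emb 1 = 1" using emb_of_real[of 1] by simp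
lemma norm_emb [simp]: "norm (emb c) = cmod c" using norm_emb_mult[of c 1] by simp
lemma emb_minus: "emb (- c) = - emb c"
  using emb_add[of c "- c"] by (simp add: eq_neg_iff_add_eq_0 add.commute)
lemma emb_diff: "emb (c - d) = emb c - emb d"
  using emb_add[of c "- d"] by (simp add: emb_minus)
lemma emb_sum: "emb (\<Sum>i\<in>I. f i) = (\<Sum>i\<in>I. emb (f i))"
  by (induction I rule: infinite_finite_induct) (auto simp: emb_add)
lemma emb_scaleR: "emb (r *\<^sub>R c) = r *\<^sub>R emb c"
  by (simp add: scaleR_conv_of_real emb_mult emb_of_real)
lemma emb_left_commute: "x * (emb c * y) = emb c * (x * y)"
  by (metis emb_commutes mult.assoc)

lemma bounded_linear_emb: "bounded_linear emb"
  by (rule bounded_linear_intro[of _ 1]) (auto simp: emb_add emb_scaleR)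

lemma continuous_on_emb [continuous_intros]: "continuous_on S f \<Longrightarrow> continuous_on S (\<lambda>x. emb (f x))"
  using bounded_linear.continuous_on[OF bounded_linear_emb] .

lemma emb_invertible: "c \<noteq> 0 \<Longrightarrow> emb c \<in> invertibles"
  by (rule invertiblesI[of _ "emb (1 / c)"]) (auto simp flip: emb_mult)

text \<open>The path \<open>exp (t * Ln c)\<close> joins \<open>1\<close> to \<open>c\<close> within
  the non-zero scalars.\<close>

lemma emb_in_open_subgroup:
  assumes G: "open_subgroup_of_invertibles G" and "c \<noteq> 0"
  shows "emb c \<in> G"
proof -
  have "emb (exp (complex_of_real 1 * Ln c)) \<in> G"
    using open_subgroup_one[OF G]
    by (intro open_subgroup_path[OF G, of "\<lambda>t. emb (exp (complex_of_real t * Ln c))"])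
       (auto intro!: continuous_intros emb_invertible)
  then show ?thesis using assms by simp
qed

text \<open>Factor out \<open>emb c\<close> and use that the unit ball about \<open>1\<close> lies
  in \<open>G\<close>. Every open subgroup thus contains the ball of radius \<open>|c|\<close> about
  each non-zero scalar \<open>c\<close>.\<close>

lemma emb_add_in_open_subgroup:
  assumes G: "open_subgroup_of_invertibles G" and "norm x < cmod c"
  shows "emb c + x \<in> G"
proof -
  have c: "c \<noteq> 0" using assms by auto
  have "norm (- (emb (1 / c) * x)) < 1"
    using assms c by (simp add: norm_emb_mult norm_divide field_simps)
  then have "emb c * (1 - - (emb (1 / c) * x)) \<in> G"
    using one_minus_in_open_subgroup emb_in_open_subgroup open_subgroup_mult G c by blast
  moreover have "emb c * (emb (1 / c) * x) = x" using c by (simp flip: mult.assoc emb_mult)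
  ultimately show ?thesis by (simp add: algebra_simps)
qed

text \<open>Converse of \<open>open_subgroup_add_jacobson_radical\<close>. Together they describe
  the radical by translations of \<open>G\<close>, which an affine bijection transports although it
  need not respect products.\<close>

lemma jacobson_radical_if_translates:
  fixes G :: "'a set"
  assumes G: "open_subgroup_of_invertibles G" and v: "\<And>g. g \<in> G \<Longrightarrow> g + v \<in> G"
  shows "v \<in> jacobson_radical"
proof (rule jacobson_radicalI)
  fix a :: 'a
  \<comment> \<open>\<open>a = (c + a) + (- c)\<close> is a sum of two elements of \<open>G\<close>, so \<open>1 + a v\<close> is reached from \<open>1\<close> in two steps.\<close>
  have step: "w + b * v \<in> G" if w: "w \<in> G" and b: "b \<in> G" for w b
  proof -
    have bi: "b \<in> invertibles" by (rule open_subgroup_invertible[OF G b])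
    have "b * (ring_inverse b * w + v) \<in> G"
      by (intro open_subgroup_mult[OF G] v open_subgroup_inverse[OF G] w b)
    then show ?thesis using bi by (simp add: distrib_left ring_inverse_right_assoc)
  qed
  define c where "c = complex_of_real (norm a + 1)"
  have "norm a < cmod c" unfolding c_def norm_of_real by simp
  then have c: "norm a < cmod c" "- c \<noteq> 0" by auto
  have "1 + (emb c + a) * v + emb (- c) * v \<in> G"
    by (intro step open_subgroup_one[OF G] emb_add_in_open_subgroup[OF G] emb_in_open_subgroup[OF G] c)
  moreover have "1 + (emb c + a) * v + emb (- c) * v = 1 + a * v"
    by (simp add: distrib_right emb_minus)
  ultimately have "1 + a * v \<in> G" by simp
  then show "\<exists>b. b * (1 + a * v) = 1"
    by (intro exI[of _ "ring_inverse (1 + a * v)"] ring_inverse_left open_subgroup_invertible[OF G])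
qed

end

section \<open>Estimates from roots of unity\<close>

text \<open>A geometric sum. This orthogonality relation extracts coefficients by finite averages in
  place of contour integrals.\<close>

lemma sum_root_unity_power:
  assumes "N > 0"
  shows "(\<Sum>j<N. (cis (2 * pi / real N) ^ j) ^ m) = (if N dvd m then of_nat N else 0)"
proof -
  let ?w = "cis (2 * pi / real N)"
  have "?w ^ m = exp (2 * of_real pi * \<i> * of_nat m / of_nat N)"
    by (simp add: cis_conv_exp flip: exp_of_nat_mult) (simp add: field_simps)
  then have 1: "?w ^ m = 1 \<longleftrightarrow> N dvd m"
    using complex_root_unity_eq_1[of N m] assms by simp
  have "?w ^ N = 1" using assms by (simp add: Complex.DeMoivre)
  have "(\<Sum>j<N. (?w ^ j) ^ m) = (\<Sum>j<N. (?w ^ m) ^ j)"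
    by (simp add: mult.commute flip: power_mult)
  also have "\<dots> = (if N dvd m then of_nat N else 0)"
  proof (cases "N dvd m")
    case True then show ?thesis using 1 by simp
  next
    case False
    then have "(\<Sum>j<N. (?w ^ m) ^ j) = ((?w ^ m) ^ N - 1) / (?w ^ m - 1)"
      using 1 by (intro geometric_sum) auto
    also have "(?w ^ m) ^ N = (?w ^ N) ^ m" by (simp add: mult.commute flip: power_mult)
    finally show ?thesis using False \<open>?w ^ N = 1\<close> by simp
  qed
  finally show ?thesis .
qed

lemma one_plus_power_eq_sum:
  fixes y :: "'a::ring_1"
  shows "(1 + y) ^ n = (\<Sum>k\<le>n. of_nat (n choose k) * y ^ k)"
proof (induction n)
  case (Suc n)
  have "(1 + y) ^ Suc n = (\<Sum>k\<le>n. of_nat (n choose k) * y ^ k) * (1 + y)"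
    unfolding power_Suc2 Suc.IH ..
  also have "\<dots> = (\<Sum>k\<le>n. of_nat (n choose k) * y ^ k) + (\<Sum>k\<le>n. of_nat (n choose k) * y ^ Suc k)"
    by (simp add: distrib_left sum_distrib_right mult.assoc power_commutes)
  also have "(\<Sum>k\<le>n. of_nat (n choose k) * y ^ k) = (\<Sum>k\<le>Suc n. of_nat (n choose k) * y ^ k)"
    by (simp add: binomial_eq_0)
  also have "\<dots> = 1 + (\<Sum>k\<le>n. of_nat (n choose Suc k) * y ^ Suc k)"
    unfolding sum.atMost_Suc_shift by simp
  finally show ?case
    unfolding sum.atMost_Suc_shift by (simp add: sum.distrib distrib_right del: power_Suc)
qed simp

lemma sum_powers_mult_one_minus:
  fixes y :: "'a::ring_1"
  shows "(1 - y) * (\<Sum>k<n. y ^ k) = 1 - y ^ n"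
  by (induction n) (simp_all add: distrib_left left_diff_distrib)

context complex_algebra
begin

lemma emb_mult_power: "(emb c * x) ^ n = emb (c ^ n) * x ^ n"
proof (induction n)
  case (Suc n)
  have "(emb c * x) ^ Suc n = emb c * (x * (emb (c ^ n) * x ^ n))"
    by (simp add: Suc mult.assoc)
  also have "\<dots> = emb c * (emb (c ^ n) * (x * x ^ n))" by (subst emb_left_commute) (rule refl)
  also have "\<dots> = emb (c ^ Suc n) * x ^ Suc n" by (simp add: emb_mult mult.assoc)
  finally show ?case .
qed simp

text \<open>Discrete Cauchy formula: average over the points \<open>R * w ^ j\<close> with weights
  \<open>(w ^ j) ^ (N - 1)\<close>, the inverses of \<open>w ^ j\<close>.\<close>

lemma cauchy_estimate_linear_coeff:
  fixes a :: "nat \<Rightarrow> 'a"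
  assumes n: "n \<ge> 1" and "R \<ge> 0"
    and bd: "\<And>z. cmod z = R \<Longrightarrow> norm (\<Sum>k\<le>n. emb (z ^ k) * a k) \<le> C"
  shows "R * norm (a 1) \<le> C"
proof -
  \<comment> \<open>More nodes than the degree, so that no index other than \<open>k = 1\<close>
    survives the averaging.\<close>
  define N where "N = Suc n"
  define w where "w = cis (2 * pi / real N)"
  have w: "cmod w = 1" by (simp add: w_def)
  have dvd: "N dvd (N - 1 + k) \<longleftrightarrow> k = 1" if "k \<le> n" for k
  proof
    assume "N dvd (N - 1 + k)"
    then obtain q where q: "N - 1 + k = N * q" by (rule dvdE)
    have "q \<noteq> 0" using q n N_def by (intro notI) auto
    moreover have "q < 2"
    proof (rule ccontr)
      assume "\<not> q < 2"
      then have "N * 2 \<le> N * q" by (intro mult_le_mono2) simp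
      then show False using q that N_def by linarith
    qed
    ultimately have "q = 1" by simp
    then show "k = 1" using q N_def by simp
  qed (simp add: N_def)
  let ?S = "\<Sum>j<N. emb ((w ^ j) ^ (N - 1)) * (\<Sum>k\<le>n. emb ((R * w ^ j) ^ k) * a k)"
  have "?S = (\<Sum>j<N. \<Sum>k\<le>n. emb (of_real R ^ k * (w ^ j) ^ (N - 1 + k)) * a k)"
  proof -
    have "emb u * (emb v * x) = emb (v * u) * x" for u v x
      by (simp add: mult.commute[of v] emb_mult mult.assoc)
    then have "emb (W ^ m) * (emb ((of_real R * W) ^ k) * x) = emb (of_real R ^ k * W ^ (m + k)) * x" for W m k x
      by (simp add: power_mult_distrib power_add ac_simps)
    then show ?thesis by (simp only: sum_distrib_left)
  qed
  also have "\<dots> = (\<Sum>k\<le>n. emb (of_real R ^ k * (\<Sum>j<N. (w ^ j) ^ (N - 1 + k))) * a k)"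
    by (subst sum.swap) (simp add: emb_sum sum_distrib_left sum_distrib_right)
  also have "\<dots> = (\<Sum>k\<le>n. if k = 1 then emb (of_real R * of_nat N) * a k else 0)"
  proof (rule sum.cong[OF refl])
    fix k assume "k \<in> {..n}"
    then have "(\<Sum>j<N. (w ^ j) ^ (N - 1 + k)) = (if k = 1 then of_nat N else 0)"
      using sum_root_unity_power[of N "N - 1 + k"] dvd[of k] by (simp add: w_def N_def)
    then show "emb (of_real R ^ k * (\<Sum>j<N. (w ^ j) ^ (N - 1 + k))) * a k =
       (if k = 1 then emb (of_real R * of_nat N) * a k else 0)" by simp
  qed
  also have "\<dots> = emb (of_real R * of_nat N) * a 1" using n by (simp add: sum.delta)
  finally have S: "?S = emb (of_real R * of_nat N) * a 1" .
  have "norm ?S \<le> (\<Sum>j<N. C)"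
  proof (rule order_trans[OF norm_sum sum_mono])
    fix j
    have "cmod (R * w ^ j) = R" using w \<open>R \<ge> 0\<close> by (simp add: norm_mult norm_power)
    then show "norm (emb ((w ^ j) ^ (N - 1)) * (\<Sum>k\<le>n. emb ((R * w ^ j) ^ k) * a k)) \<le> C"
      using bd by (simp add: norm_emb_mult norm_power w)
  qed
  then have "real N * (R * norm (a 1)) \<le> real N * C"
    unfolding S using \<open>R \<ge> 0\<close> by (simp add: norm_emb_mult norm_mult ac_simps)
  then show ?thesis by (simp add: N_def)
qed

text \<open>The polynomial \<open>(1 + z d)\<^sup>n\<close> is bounded by \<open>1\<close> for \<open>|z| = R\<close>, while its linear coefficient is \<open>n d\<close>.\<close>

lemma eq_zero_if_norm_one_plus_le:
  assumes "R > 0" and bd: "\<And>z. cmod z = R \<Longrightarrow> norm (1 + emb z * d) \<le> 1"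
  shows "d = 0"
proof (rule ccontr)
  assume "d \<noteq> 0"
  obtain n0 :: nat where "real n0 > 1 / (R * norm d)" using reals_Archimedean2 by blast
  then have n: "real (Suc n0) > 1 / (R * norm d)" "Suc n0 \<ge> 1" by simp_all
  define n where "n = Suc n0"
  note n = n[folded n_def]
  have "R * norm ((of_nat (n choose 1) :: 'a) * d ^ 1) \<le> 1"
  proof (rule cauchy_estimate_linear_coeff[OF n(2), where a = "\<lambda>k. of_nat (n choose k) * d ^ k"])
    fix z assume z: "cmod z = R"
    have "(\<Sum>k\<le>n. emb (z ^ k) * (of_nat (n choose k) * d ^ k)) = (1 + emb z * d) ^ n"
      unfolding one_plus_power_eq_sum emb_mult_power
      by (intro sum.cong refl) (metis emb_left_commute)
    moreover have "norm ((1 + emb z * d) ^ n) \<le> norm (1 + emb z * d) ^ n" by (rule norm_power_ineq)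
    moreover have "\<dots> \<le> 1" using bd[OF z] by (simp add: power_le_one)
    ultimately show "norm (\<Sum>k\<le>n. emb (z ^ k) * (of_nat (n choose k) * d ^ k)) \<le> 1" by simp
  qed (use assms in simp)
  moreover have "norm ((of_nat n :: 'a) * d) = real n * norm d"
    by (metis norm_scaleR abs_of_nat scaleR_conv_of_real of_real_of_nat_eq)
  ultimately have "real n * (R * norm d) \<le> 1" by (simp add: mult.left_commute)
  then show False using n \<open>d \<noteq> 0\<close> \<open>R > 0\<close> by (simp add: field_simps)
qed

section \<open>Characters of commutative Banach algebras\<close>

text \<open>Rickart's proof, which needs neither Hahn--Banach nor Liouville. If no \<open>x - c\<close> vanishes modulo the kernel of \<open>q\<close>,
  then \<open>g z = (1 - z x)\<^sup>-\<^sup>1\<close> exists modulo this kernel for every \<open>z\<close> and is uniformly continuous on discs. Its average over the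
  points \<open>r \<omega>\<^sup>j\<close>, for \<open>\<omega>\<close> a primitive \<open>N\<close>-th root of unity, is \<open>(1 - r\<^sup>N x\<^sup>N)\<^sup>-\<^sup>1\<close>, so smallness of \<open>r\<^sup>N q(x\<^sup>N)\<close> for some \<open>N\<close>
  propagates from \<open>r\<close> to all nearby radii, with a step size that does not depend on \<open>N\<close>. This contradicts the invertibility of \<open>x\<close>.\<close>

lemma gelfand_mazur_seminorm:
  fixes q :: "'a \<Rightarrow> real" and x :: 'a
  assumes comm: "\<And>a b :: 'a. a * b = b * a"
    and q_add: "\<And>a b. q (a + b) \<le> q a + q b"
    and q_mult: "\<And>a b. q (a * b) \<le> q a * q b"
    and q_emb: "\<And>c a. q (emb c * a) = cmod c * q a"
    and q_1: "q 1 = 1"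
    and division: "\<And>a. q a \<noteq> 0 \<Longrightarrow> \<exists>b. q (b * a - 1) = 0"
  shows "\<exists>c. q (x - emb c) = 0"
proof (rule ccontr)
  assume "\<not> ?thesis"
  then have nz: "q (x - emb c) \<noteq> 0" for c by blast
  have q_0: "q 0 = 0" using q_emb[of 0 0] by simp
  have q_minus: "q (- a) = q a" for a using q_emb[of "- 1" a] by (simp add: emb_minus)
  have q_nonneg: "q a \<ge> 0" for a using q_add[of a "- a"] by (simp add: q_0 q_minus)
  have q_diff: "q (a - b) \<le> q a + q b" for a b using q_add[of a "- b"] by (simp add: q_minus)
  have q_le: "q a \<le> q b + q (a - b)" for a b using q_add[of b "a - b"] by simp
  have q_diff_commute: "q (a - b) = q (b - a)" for a b using q_minus[of "a - b"] by simp
  have q_mult0: "q (a * b) = 0" if "q b = 0" for a b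
    using q_mult[of a b] q_nonneg[of "a * b"] that by simp
  have q_add0: "q (a + b) = 0" if "q a = 0" "q b = 0" for a b
    using q_add[of a b] q_nonneg[of "a + b"] that by simp
  have q_diff0: "q (a - b) = 0" if "q a = 0" "q b = 0" for a b
    using q_diff[of a b] q_nonneg[of "a - b"] that by simp
  have q_sum0: "q (sum f I) = 0" if "\<And>i. i \<in> I \<Longrightarrow> q (f i) = 0" for f and I :: "nat set"
    using that by (induction I rule: infinite_finite_induct) (auto simp: q_0 q_add0)
  \<comment> \<open>Together with the ideal properties of the kernel of \<open>q\<close> above, this
    replaces passing to a quotient algebra.\<close>
  have q_eq: "q a = q b" if "q (a - b) = 0" for a b
    using q_le[of a b] q_le[of b a] that q_diff_commute[of a b] by linarith
  have q_sum: "q (sum f I) \<le> (\<Sum>i\<in>I. q (f i))" for f and I :: "nat set"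
  proof (induction I rule: infinite_finite_induct)
    case (insert i I)
    then show ?case using q_add[of "f i" "sum f I"] by simp
  qed (auto simp: q_0)
  have q_power: "q (a ^ n) \<le> q a ^ n" for a n
  proof (induction n)
    case (Suc n)
    have "q (a ^ Suc n) \<le> q a * q (a ^ n)" using q_mult[of a "a ^ n"] by simp
    also have "\<dots> \<le> q a * q a ^ n" using Suc q_nonneg by (intro mult_left_mono) auto
    finally show ?case by simp
  qed (simp add: q_1)
  have "\<exists>b. q (b * (1 - emb z * x) - 1) = 0" for z
  proof (rule division, cases "z = 0")
    case False
    then have "1 - emb z * x = emb (- z) * (x - emb (1 / z))"
      by (simp add: emb_minus right_diff_distrib flip: emb_mult)
    then show "q (1 - emb z * x) \<noteq> 0" using nz[of "1 / z"] False by (simp add: q_emb)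
  qed (simp add: q_1)
  then obtain g where g: "\<And>z. q (g z * (1 - emb z * x) - 1) = 0" by metis
  \<comment> \<open>The resolvent identity \<open>g z - g w = (z - w) x (g z) (g w)\<close>, modulo
    the kernel of \<open>q\<close>.\<close>
  have g_diff: "q (g z - g w) \<le> cmod (z - w) * (q x * (q (g z) * q (g w)))" for z w
  proof -
    have "q (g w * (g z * (1 - emb z * x) - 1) - g z * (g w * (1 - emb w * x) - 1)) = 0"
      by (intro q_diff0 q_mult0 g)
    also have "g w * (g z * (1 - emb z * x) - 1) - g z * (g w * (1 - emb w * x) - 1)
      = (g z - g w) - (g z * g w) * (emb z * x - emb w * x)"
      using comm[of "g w" "g z"] by (simp add: algebra_simps flip: mult.assoc)
    also have "emb z * x - emb w * x = emb (z - w) * x" by (simp add: emb_diff left_diff_distrib)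
    also have "(g z * g w) * (emb (z - w) * x) = emb (z - w) * (x * (g z * g w))"
      by (subst emb_left_commute, subst comm[of x]) (rule refl)
    finally have "q (g z - g w) = q (emb (z - w) * (x * (g z * g w)))" by (rule q_eq)
    also have "\<dots> = cmod (z - w) * q (x * (g z * g w))" by (rule q_emb)
    also have "q (x * (g z * g w)) \<le> q x * q (g z * g w)" by (rule q_mult)
    also have "q (g z * g w) \<le> q (g z) * q (g w)" by (rule q_mult)
    finally show ?thesis using q_nonneg by (simp add: mult_left_mono)
  qed
  have g_cont: "continuous_on UNIV (\<lambda>z. q (g z))"
    unfolding continuous_on_iff
  proof (intro ballI allI impI)
    fix z :: complex and e :: real assume e: "e > 0"
    define K where "K = q (g z)"
    define A where "A = q x * K"
    have A: "A \<ge> 0" "K \<ge> 0" unfolding A_def K_def using q_nonneg by auto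
    \<comment> \<open>The first bound gives \<open>q (g w) \<le> 2 * K\<close> near
      \<open>z\<close>; the second then makes the difference smaller than \<open>e\<close>.\<close>
    define d where "d = min (1 / (2 * (A + 1))) (e / (2 * A * K + 1))"
    have AK: "2 * A * K \<ge> 0" using A by simp
    have AK1: "2 * A * K + 1 > 0" "A + 1 > 0" using A AK by linarith+
    have "d > 0" unfolding d_def using AK1 e by (simp only: min_less_iff_conj) simp
    moreover have "dist (q (g w)) (q (g z)) < e" if "dist w z < d" for w
    proof -
      let ?t = "cmod (z - w)"
      have t: "?t < 1 / (2 * (A + 1))" "?t < e / (2 * A * K + 1)"
        using that by (auto simp: d_def dist_norm norm_minus_commute)
      have "?t * (A + 1) < 1 / 2" "?t * (2 * A * K + 1) < e"
        using t AK1 by (simp_all add: pos_less_divide_eq algebra_simps)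
      then have t': "?t * A \<le> 1 / 2" "?t * (2 * A * K) < e"
        using norm_ge_zero[of "z - w"] unfolding distrib_left by linarith+
      have gd: "q (g z - g w) \<le> ?t * A * q (g w)"
        using g_diff[of z w] by (simp add: A_def K_def mult.assoc)
      also have "\<dots> \<le> 1 / 2 * q (g w)" using t' q_nonneg by (intro mult_right_mono)
      finally have "q (g w) \<le> 2 * K" using q_le[of "g w" "g z"] q_diff_commute[of "g z" "g w"] by (simp add: K_def)
      then have "?t * A * q (g w) \<le> ?t * A * (2 * K)" using A by (intro mult_left_mono) auto
      with gd have "q (g z - g w) < e" using t' by (simp add: ac_simps)
      then show ?thesis using q_le[of "g w" "g z"] q_le[of "g z" "g w"] q_diff_commute[of "g z" "g w"]
        by (simp add: dist_real_def abs_if)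
    qed
    ultimately show "\<exists>d>0. \<forall>w\<in>UNIV. dist w z < d \<longrightarrow> dist (q (g w)) (q (g z)) < e" by blast
  qed
  obtain y where y: "q (y * x - 1) = 0" using division nz[of 0] by auto
  \<comment> \<open>The radius for the contradiction: \<open>y\<close> inverts \<open>x\<close>
    modulo the kernel, so \<open>1 \<le> R ^ N * q (x ^ N)\<close> for every
    \<open>N\<close>.\<close>
  define R where "R = q y"
  have "R \<ge> 0" unfolding R_def by (rule q_nonneg)
  have "compact ((\<lambda>z. q (g z)) ` cball 0 R)"
    by (intro compact_continuous_image continuous_on_subset[OF g_cont]) auto
  then obtain K where K: "\<And>z. cmod z \<le> R \<Longrightarrow> q (g z) \<le> K"
    using compact_imp_bounded bounded_real by (metis abs_le_D1 imageI mem_cball_0)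
  have "K \<ge> 0" using K[of 0] q_nonneg[of "g 0"] \<open>R \<ge> 0\<close> by simp
  define d where "d = 1 / (3 * (q x * (K * K)) + 1)"
  have qK: "q x * (K * K) \<ge> 0" using q_nonneg by simp
  have "d > 0" unfolding d_def using qK by (intro divide_pos_pos) auto
  have g_unif: "q (g z - g w) \<le> 1 / 3" if "cmod z \<le> R" "cmod w \<le> R" "cmod (z - w) \<le> d" for z w
  proof -
    have "q (g z) * q (g w) \<le> K * K" using K that q_nonneg \<open>K \<ge> 0\<close> by (intro mult_mono) auto
    then have le: "q x * (q (g z) * q (g w)) \<le> q x * (K * K)" using q_nonneg by (intro mult_left_mono)
    have "cmod (z - w) * (q x * (q (g z) * q (g w))) \<le> d * (q x * (K * K))"
      by (rule mult_mono[OF that(3) le]) (use \<open>d > 0\<close> q_nonneg in auto)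
    also have "\<dots> \<le> 1 / 3" using qK unfolding d_def by (simp add: field_simps)
    finally show ?thesis using g_diff[of z w] by linarith
  qed
  define h where "h N r = emb (1 / of_nat N) * (\<Sum>j<N. g (of_real r * cis (2 * pi / real N) ^ j))"
    for N :: nat and r :: real
  \<comment> \<open>Each node has \<open>N\<close>-th power \<open>r ^ N\<close>, so
    \<open>1 - ?z j * x\<close> divides \<open>?Y\<close> with a geometric sum as quotient. Summed
    over the nodes, only the constant terms of these quotients survive.\<close>
  have h_inv: "q (h N r * (1 - emb (of_real r ^ N) * x ^ N) - 1) = 0" if "N > 0" for N r
  proof -
    let ?w = "cis (2 * pi / real N)"
    let ?z = "\<lambda>j. of_real r * ?w ^ j"
    let ?Y = "1 - emb (of_real r ^ N) * x ^ N"
    have wN: "(?w ^ j) ^ N = 1" for j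
    proof -
      have "?w ^ N = 1" using that by (simp add: Complex.DeMoivre)
      then show ?thesis by (metis power_mult mult.commute power_one)
    qed
    have Y: "?Y = (1 - emb (?z j) * x) * (\<Sum>k<N. (emb (?z j) * x) ^ k)" for j
      by (simp only: sum_powers_mult_one_minus) (simp add: emb_mult_power power_mult_distrib wN)
    have "q (g (?z j) * ?Y - (\<Sum>k<N. (emb (?z j) * x) ^ k)) = 0" for j
    proof -
      let ?s = "\<Sum>k<N. (emb (?z j) * x) ^ k"
      have "g (?z j) * ?Y - ?s = ?s * (g (?z j) * (1 - emb (?z j) * x) - 1)"
      proof -
        have "g (?z j) * ?Y = g (?z j) * (1 - emb (?z j) * x) * ?s" unfolding Y[of j] by (simp only: mult.assoc)
        also have "\<dots> = ?s * (g (?z j) * (1 - emb (?z j) * x))" by (rule comm)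
        finally show ?thesis by (simp only: right_diff_distrib mult_1_right)
      qed
      then show ?thesis using q_mult0[OF g] by simp
    qed
    then have "q (\<Sum>j<N. g (?z j) * ?Y - (\<Sum>k<N. (emb (?z j) * x) ^ k)) = 0" by (rule q_sum0)
    moreover have "(\<Sum>j<N. \<Sum>k<N. (emb (?z j) * x) ^ k) = emb (of_nat N)"
    proof -
      have "(\<Sum>j<N. \<Sum>k<N. (emb (?z j) * x) ^ k) = (\<Sum>k<N. \<Sum>j<N. emb (of_real r ^ k * (?w ^ j) ^ k) * x ^ k)"
        unfolding emb_mult_power power_mult_distrib by (rule sum.swap)
      also have "\<dots> = (\<Sum>k<N. emb (of_real r ^ k * (\<Sum>j<N. (?w ^ j) ^ k)) * x ^ k)"
        by (simp add: emb_sum sum_distrib_left sum_distrib_right)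
      also have "\<dots> = (\<Sum>k<N. if k = 0 then emb (of_nat N) else 0)"
      proof (rule sum.cong[OF refl])
        fix k assume k: "k \<in> {..<N}"
        then have "N dvd k \<longleftrightarrow> k = 0" by (auto dest: dvd_imp_le)
        then show "emb (of_real r ^ k * (\<Sum>j<N. (?w ^ j) ^ k)) * x ^ k = (if k = 0 then emb (of_nat N) else 0)"
          unfolding sum_root_unity_power[OF that] by simp
      qed
      also have "\<dots> = emb (of_nat N)" using that by (simp add: sum.delta)
      finally show ?thesis .
    qed
    ultimately have "q ((\<Sum>j<N. g (?z j)) * ?Y - emb (of_nat N)) = 0"
      by (simp add: sum_subtractf sum_distrib_right)
    then have "q (emb (1 / of_nat N) * ((\<Sum>j<N. g (?z j)) * ?Y - emb (of_nat N))) = 0" by (rule q_mult0)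
    then show ?thesis using that unfolding h_def by (simp add: right_diff_distrib mult.assoc flip: emb_mult)
  qed
  have h_diff: "q (h N r - h N s) \<le> 1 / 3"
    if "N > 0" "0 \<le> r" "r \<le> R" "0 \<le> s" "s \<le> R" "\<bar>r - s\<bar> \<le> d" for N r s
  proof -
    let ?w = "cis (2 * pi / real N)"
    have "h N r - h N s = emb (1 / of_nat N) * (\<Sum>j<N. g (of_real r * ?w ^ j) - g (of_real s * ?w ^ j))"
      unfolding h_def by (simp add: sum_subtractf right_diff_distrib)
    then have "q (h N r - h N s) = 1 / real N * q (\<Sum>j<N. g (of_real r * ?w ^ j) - g (of_real s * ?w ^ j))"
      by (simp add: q_emb norm_divide)
    moreover have "q (\<Sum>j<N. g (of_real r * ?w ^ j) - g (of_real s * ?w ^ j)) \<le> (\<Sum>j<N. 1 / 3)"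
    proof (rule order_trans[OF q_sum sum_mono])
      fix j
      have "of_real r * ?w ^ j - of_real s * ?w ^ j = of_real (r - s) * ?w ^ j" by (simp add: left_diff_distrib)
      then have "cmod (of_real r * ?w ^ j - of_real s * ?w ^ j) = \<bar>r - s\<bar>"
        by (simp only: norm_mult norm_power norm_cis norm_of_real) simp
      then show "q (g (of_real r * ?w ^ j) - g (of_real s * ?w ^ j)) \<le> 1 / 3"
        using that by (intro g_unif) (auto simp: norm_mult norm_power)
    qed
    ultimately have "real N * q (h N r - h N s) \<le> real N * (1 / 3)" using \<open>N > 0\<close> by simp
    then show ?thesis by (rule mult_left_le_imp_le) (simp add: \<open>N > 0\<close>)
  qed
  \<comment> \<open>The threshold reproduces itself: the 11th power of \<open>4 / 5\<close> is below
    \<open>1 / 10\<close>, so \<open>h N r\<close> is within \<open>1 / 9\<close> of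
    \<open>1\<close> and \<open>h N s\<close> within \<open>1 / 9 + 1 / 3 = 4 / 9\<close>. Then
    \<open>q v \<le> 4 / 9 * (1 + q v)\<close> gives \<open>4 / 5\<close> again.\<close>
  define P where "P r \<longleftrightarrow> (\<exists>N\<ge>1. r ^ N * q (x ^ N) \<le> 4 / 5)" for r :: real
  have P_step: "P s" if "P r" "0 \<le> r" "r \<le> R" "0 \<le> s" "s \<le> R" "\<bar>r - s\<bar> \<le> d" for r s
  proof -
    obtain M where M: "M \<ge> 1" "r ^ M * q (x ^ M) \<le> 4 / 5" using \<open>P r\<close> unfolding P_def by blast
    define N where "N = M * 11"
    have N: "N > 0" using M by (simp add: N_def)
    define u where "u = emb (of_real r ^ N) * x ^ N"
    define v where "v = emb (of_real s ^ N) * x ^ N"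
    have qu: "q u \<le> 1 / 10"
    proof -
      have "q u = r ^ N * q (x ^ N)" unfolding u_def q_emb using that by (simp add: norm_power)
      also have "\<dots> \<le> r ^ N * q (x ^ M) ^ 11"
        unfolding N_def power_mult using that by (intro mult_left_mono q_power) auto
      also have "\<dots> = (r ^ M * q (x ^ M)) ^ 11" by (simp add: N_def power_mult power_mult_distrib)
      also have "\<dots> \<le> (4 / 5) ^ 11" using M that q_nonneg by (intro power_mono) auto
      also have "\<dots> \<le> 1 / 10" by (simp add: power_divide)
      finally show ?thesis .
    qed
    let ?h = "h N r" and ?k = "h N s"
    have "q (?h - 1 - ?h * u) = 0" using h_inv[OF N, of r] by (simp add: u_def algebra_simps)
    then have "q (?h - 1) = q (?h * u)" by (rule q_eq)
    also have "\<dots> \<le> q ?h * (1 / 10)" using q_mult[of ?h u] mult_left_mono[OF qu q_nonneg[of ?h]] by linarith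
    finally have "q (?h - 1) \<le> q ?h * (1 / 10)" .
    moreover have "q ?h \<le> 1 + q (?h - 1)" using q_le[of ?h 1] by (simp add: q_1)
    ultimately have h1: "q (?h - 1) \<le> 1 / 9" by simp
    have "q (?k - 1) \<le> q (?h - 1) + q (?k - ?h)" using q_add[of "?h - 1" "?k - ?h"] by simp
    then have k1: "q (?k - 1) \<le> 4 / 9"
      using h1 h_diff[OF N that(2-6)] q_diff_commute[of ?h ?k] by simp
    have "q (v - (?k - 1) * (1 - v)) = 0"
      using h_inv[OF N, of s] q_minus[of "?k * (1 - v) - 1"] by (simp add: v_def algebra_simps)
    then have "q v = q ((?k - 1) * (1 - v))" by (rule q_eq)
    also have "\<dots> \<le> q (?k - 1) * q (1 - v)" by (rule q_mult)
    also have "\<dots> \<le> 4 / 9 * (1 + q v)" using k1 q_diff[of 1 v] q_nonneg by (intro mult_mono) (auto simp: q_1)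
    finally have "q v \<le> 4 / 5" by simp
    moreover have "q v = s ^ N * q (x ^ N)" unfolding v_def q_emb using that by (simp add: norm_power)
    ultimately show ?thesis unfolding P_def using N by (intro exI[of _ N]) auto
  qed
  have "P R"
  proof -
    \<comment> \<open>\<open>R\<close> is reached from \<open>0\<close>, where \<open>P\<close> is
      trivial, by steps of length \<open>R / n\<close>, at most \<open>d\<close>.\<close>
    obtain n0 :: nat where "real n0 > R / d" using reals_Archimedean2 by blast
    then have n: "real (Suc n0) * d \<ge> R" using \<open>d > 0\<close> by (simp add: field_simps)
    define n where "n = Suc n0"
    have "P (real k * R / real n)" if "k \<le> n" for k
      using that
    proof (induction k)
      case 0
      show ?case unfolding P_def by (intro exI[of _ 1]) auto
    next
      case (Suc k)
      have b: "0 \<le> real j * R / real n \<and> real j * R / real n \<le> R" if "j \<le> n" for j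
      proof -
        have "real j * R \<le> real n * R" using that \<open>R \<ge> 0\<close> by (intro mult_right_mono) auto
        then show ?thesis using \<open>R \<ge> 0\<close> by (simp add: n_def divide_le_eq mult.commute)
      qed
      have "real k * R / real n - real (Suc k) * R / real n = - (R / real n)"
        by (simp add: distrib_right add_divide_distrib)
      moreover have "R / real n \<le> d" using n by (simp add: n_def divide_le_eq mult.commute)
      moreover have "R / real n \<ge> 0" using \<open>R \<ge> 0\<close> by simp
      ultimately have "\<bar>real k * R / real n - real (Suc k) * R / real n\<bar> \<le> d" by linarith
      then show ?case using P_step[OF Suc.IH] b[of k] b[of "Suc k"] Suc.prems by simp
    qed
    from this[of n] show ?thesis by (simp add: n_def)
  qed
  then obtain N where N: "N \<ge> 1" "R ^ N * q (x ^ N) \<le> 4 / 5" unfolding P_def by blast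
  have "q ((y * x) ^ N - 1) = 0"
  proof -
    have "(y * x) ^ N - 1 = (\<Sum>k<N. (y * x) ^ k) * (y * x - 1)"
      using sum_powers_mult_one_minus[of "y * x" N] comm[of "\<Sum>k<N. (y * x) ^ k" "y * x - 1"]
      by (simp add: algebra_simps)
    then show ?thesis using q_mult0[OF y] by simp
  qed
  then have "1 = q ((y * x) ^ N)" using q_eq q_1 by metis
  also have "(y * x) ^ N = y ^ N * x ^ N"
    by (induction N) (simp_all add: mult.assoc, metis comm mult.assoc)
  also have "q (y ^ N * x ^ N) \<le> q (y ^ N) * q (x ^ N)" by (rule q_mult)
  also have "\<dots> \<le> R ^ N * q (x ^ N)" unfolding R_def using q_nonneg by (intro mult_right_mono q_power)
  finally show False using N by simp
qed

text \<open>The distance to \<open>M\<close> is the quotient seminorm of the field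
  \<open>A / M\<close>. By \<open>gelfand_mazur_seminorm\<close> each \<open>x\<close> is a scalar
  modulo its kernel, and \<open>\<phi> x\<close> is that scalar.\<close>

lemma character_exists:
  fixes M :: "'a set"
  assumes comm: "\<And>a b :: 'a. a * b = b * a" and M: "maximal_left_ideal M" and v: "v \<notin> M"
  obtains \<phi> :: "'a \<Rightarrow> complex"
  where "\<And>x y. \<phi> (x + y) = \<phi> x + \<phi> y" and "\<And>x y. \<phi> (x * y) = \<phi> x * \<phi> y"
    and "\<And>c. \<phi> (emb c) = c" and "\<And>x. cmod (\<phi> x) \<le> norm x" and "\<phi> v \<noteq> 0"
proof -
  have LM: "left_ideal M" using M unfolding maximal_left_ideal_def by blast
  have M0: "0 \<in> M" and M_add: "\<And>x y. x \<in> M \<Longrightarrow> y \<in> M \<Longrightarrow> x + y \<in> M"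
    and M_minus: "\<And>x. x \<in> M \<Longrightarrow> - x \<in> M" and M_mult: "\<And>a x. x \<in> M \<Longrightarrow> a * x \<in> M"
    using LM unfolding left_ideal_def by blast+
  have M_diff: "x - y \<in> M" if "x \<in> M" "y \<in> M" for x y using M_add[OF that(1) M_minus[OF that(2)]] by simp
  define q where "q x = infdist x M" for x
  have ne: "M \<noteq> {}" using M0 by blast
  have q_le: "q x \<le> norm (x - m)" if "m \<in> M" for x m
    using infdist_le[OF that] unfolding q_def dist_norm .
  have q_ge: "B \<le> q x" if "\<And>m. m \<in> M \<Longrightarrow> B \<le> norm (x - m)" for B x
    unfolding q_def infdist_notempty[OF ne] dist_norm using that by (intro cINF_greatest ne)
  have q_approx: "\<exists>m\<in>M. norm (x - m) < q x + e" if "e > 0" for x e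
  proof (rule ccontr)
    assume "\<not> ?thesis"
    then have "q x + e \<le> q x" by (intro q_ge) auto
    then show False using that by simp
  qed
  have q_nonneg: "q x \<ge> 0" for x by (simp add: q_def infdist_nonneg)
  have q_M: "q x = 0" if "x \<in> M" for x using q_le[OF that, of x] q_nonneg[of x] by simp
  have q_add: "q (x + y) \<le> q x + q y" for x y
  proof (rule field_le_epsilon)
    fix e :: real assume "e > 0"
    then obtain m n where mn: "m \<in> M" "norm (x - m) < q x + e / 2" "n \<in> M" "norm (y - n) < q y + e / 2"
      using q_approx[of "e / 2"] by (meson half_gt_zero)
    have "q (x + y) \<le> norm (x + y - (m + n))" using mn by (intro q_le M_add)
    also have "\<dots> \<le> norm (x - m) + norm (y - n)" using norm_triangle_ineq[of "x - m" "y - n"] by (simp add: algebra_simps)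
    finally show "q (x + y) \<le> q x + q y + e" using mn by linarith
  qed
  have q_mult1: "q (x * y) \<le> norm (x - m) * norm (y - n)" if "m \<in> M" "n \<in> M" for x y m n
  proof -
    have "x * y - (x * n + (y * m - n * m)) = (x - m) * (y - n)"
      using comm[of y m] comm[of n m] by (simp add: algebra_simps)
    moreover have "x * n + (y * m - n * m) \<in> M" using that by (intro M_add M_diff M_mult)
    ultimately have "q (x * y) \<le> norm ((x - m) * (y - n))" using q_le by metis
    also have "\<dots> \<le> norm (x - m) * norm (y - n)" by (rule norm_mult_ineq)
    finally show ?thesis .
  qed
  have q_mult: "q (x * y) \<le> q x * q y" for x y
  proof -
    have 1: "q (x * y) \<le> q x * norm (y - n)" if "n \<in> M" for n
    proof (cases "norm (y - n) = 0")
      case True then show ?thesis using q_mult1[OF M0 that, of x y] by simp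
    next
      case False
      then have "q (x * y) / norm (y - n) \<le> q x"
        using q_mult1[OF _ that, of _ x y] by (intro q_ge) (simp add: divide_le_eq)
      then show ?thesis using False by (simp add: divide_le_eq)
    qed
    show ?thesis
    proof (cases "q x = 0")
      case True then show ?thesis using 1[OF M0] by simp
    next
      case False
      then have x: "q x > 0" using q_nonneg[of x] by simp
      then have "q (x * y) / q x \<le> q y"
        using 1 by (intro q_ge) (simp add: divide_le_eq mult.commute)
      then show ?thesis using x by (simp add: divide_le_eq mult.commute)
    qed
  qed
  have q_emb_le: "q (emb c * x) \<le> cmod c * q x" for c x
  proof (cases "c = 0")
    case True then show ?thesis using q_M[OF M0] by simp
  next
    case False
    have "q (emb c * x) \<le> cmod c * norm (x - m)" if "m \<in> M" for m
      using q_le[OF M_mult[OF that], of "emb c * x" "emb c"] by (simp add: norm_emb_mult flip: right_diff_distrib)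
    then have "q (emb c * x) / cmod c \<le> q x" using False by (intro q_ge) (simp add: divide_le_eq mult.commute)
    then show ?thesis using False by (simp add: divide_le_eq mult.commute)
  qed
  have q_emb: "q (emb c * x) = cmod c * q x" for c x
  proof (cases "c = 0")
    case True then show ?thesis using q_M[OF M0] by simp
  next
    case False
    have "q x = q (emb (1 / c) * (emb c * x))" using False by (simp flip: mult.assoc emb_mult)
    also have "\<dots> \<le> cmod (1 / c) * q (emb c * x)" by (rule q_emb_le)
    finally show ?thesis using q_emb_le[of c x] False by (simp add: norm_divide field_simps)
  qed
  have q_norm: "q x \<le> norm x" for x using q_le[OF M0, of x] by simp
  have q_1: "q 1 = 1"
  proof (rule antisym)
    show "q 1 \<le> 1" using q_norm[of 1] by simp
    \<comment> \<open>An element of \<open>M\<close> closer to \<open>1\<close> would be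
      invertible.\<close>
    show "1 \<le> q 1"
    proof (rule q_ge, rule ccontr)
      fix m assume m: "m \<in> M" "\<not> 1 \<le> norm (1 - m)"
      then have "m \<in> invertibles" using one_minus_invertible[of "1 - m"] by simp
      then have "1 \<in> M" using M_mult[OF m(1)] ring_inverse_left by metis
      then show False using maximal_left_ideal_one[OF M] by simp
    qed
  qed
  have div: "\<exists>b. q (b * a - 1) = 0" if "a \<notin> M" for a
    using maximal_left_ideal_left_inverse[OF M that] q_M by blast
  have "\<exists>c. q (x - emb c) = 0" for x
    using comm q_add q_mult q_emb q_1 div q_M by (intro gelfand_mazur_seminorm) blast+
  then obtain \<phi> where \<phi>: "\<And>x. q (x - emb (\<phi> x)) = 0" by metis
  have q_diff: "q (x - y) \<le> q x + q y" for x y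
    using q_add[of x "- y"] q_emb[of "- 1" y] by (simp add: emb_minus)
  have q_emb_1: "q (emb c) = cmod c" for c using q_emb[of c 1] q_1 by simp
  have uniq: "\<phi> x = c" if "q (x - emb c) = 0" for x c
  proof -
    have "q ((x - emb c) - (x - emb (\<phi> x))) \<le> 0" using q_diff[of "x - emb c" "x - emb (\<phi> x)"] that \<phi>[of x] by simp
    then have "cmod (\<phi> x - c) \<le> 0" using q_emb_1[of "\<phi> x - c"] by (simp add: emb_diff)
    then show ?thesis by simp
  qed
  have add: "\<phi> (x + y) = \<phi> x + \<phi> y" for x y
  proof (rule uniq, rule antisym[OF _ q_nonneg])
    have "x + y - emb (\<phi> x + \<phi> y) = (x - emb (\<phi> x)) + (y - emb (\<phi> y))" by (simp add: emb_add)
    then show "q (x + y - emb (\<phi> x + \<phi> y)) \<le> 0" using q_add \<phi> by (metis add.right_neutral)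
  qed
  have mult: "\<phi> (x * y) = \<phi> x * \<phi> y" for x y
  proof (rule uniq, rule antisym[OF _ q_nonneg])
    have "x * y - emb (\<phi> x * \<phi> y) = x * (y - emb (\<phi> y)) + emb (\<phi> y) * (x - emb (\<phi> x))"
      using emb_commutes[of "\<phi> y" x] by (simp add: right_diff_distrib mult.commute[of "\<phi> x"] emb_mult)
    then have "q (x * y - emb (\<phi> x * \<phi> y)) \<le> q (x * (y - emb (\<phi> y))) + q (emb (\<phi> y) * (x - emb (\<phi> x)))"
      using q_add by metis
    also have "\<dots> \<le> 0" using q_mult[of x "y - emb (\<phi> y)"] \<phi> by (simp add: q_emb)
    finally show "q (x * y - emb (\<phi> x * \<phi> y)) \<le> 0" .
  qed
  have emb: "\<phi> (emb c) = c" for c using uniq[of "emb c" c] q_M[OF M0] by simp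
  have bound: "cmod (\<phi> x) \<le> norm x" for x
  proof -
    have "cmod (\<phi> x) = q (x - (x - emb (\<phi> x)))" by (simp add: q_emb_1)
    also have "\<dots> \<le> q x" using q_diff[of x "x - emb (\<phi> x)"] \<phi> by simp
    finally show ?thesis using q_norm[of x] by simp
  qed
  have "\<phi> v \<noteq> 0"
  proof
    assume "\<phi> v = 0"
    obtain b where "q (b * v - 1) = 0" using div[OF v] by blast
    then have "\<phi> (b * v) = 1" using uniq[of "b * v" 1] by simp
    then show False using mult \<open>\<phi> v = 0\<close> by simp
  qed
  then show thesis using that add mult emb bound by blast
qed

end

section \<open>A real linear Gleason--Kahane--Zelazko theorem\<close>

text \<open>If \<open>p = \<Prod> (1 - z / \<rho>\<^sub>i)\<close>, the left-hand side is the modulus of \<open>\<Sum> \<rho>\<^sub>i\<^sup>-\<^sup>2\<close>.\<close>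

lemma norm_sum_inverse_roots_squared_le:
  fixes p :: "complex poly"
  assumes "coeff p 0 = 1" and "degree p \<le> n" and "R > 0"
    and "\<And>z. cmod z < R \<Longrightarrow> poly p z \<noteq> 0"
  shows "cmod ((coeff p 1)\<^sup>2 - 2 * coeff p 2) \<le> real n / R\<^sup>2"
  using assms
proof (induction n arbitrary: p)
  case 0
  then have "coeff p 1 = 0" "coeff p 2 = 0" by (simp_all add: coeff_eq_0)
  then show ?case by simp
next
  case (Suc n)
  show ?case
  proof (cases "degree p = 0")
    case True
    then have "coeff p 1 = 0" "coeff p 2 = 0" by (simp_all add: coeff_eq_0)
    then show ?thesis by simp
  next
    case False
    then have "\<not> constant (poly p)" by (simp add: constant_degree)
    then obtain r where r: "poly p r = 0" using fundamental_theorem_of_algebra by blast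
    have "cmod r \<ge> R" using Suc.prems(4)[of r] r by force
    then have r0: "r \<noteq> 0" using Suc.prems(3) by auto
    from r obtain s where s: "p = [:- r, 1:] * s" unfolding poly_eq_0_iff_dvd by (auto elim: dvdE)
    \<comment> \<open>Normalised so that \<open>p = (1 - z / r) * q\<close> and \<open>q\<close>
      again has constant term \<open>1\<close>; splitting off this factor removes
      \<open>1 / r\<^sup>2\<close> from the sum.\<close>
    define q where "q = smult (- r) s"
    have pq: "p = q - smult (1 / r) (pCons 0 q)" unfolding s q_def using r0 by simp
    have pq': "p = [:1, - 1 / r:] * q" unfolding pq by simp
    have c: "coeff p 0 = coeff q 0" "coeff p 1 = coeff q 1 - coeff q 0 / r"
      "coeff p 2 = coeff q 2 - coeff q 1 / r"
      unfolding pq by (simp_all add: numeral_2_eq_2)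
    have "q \<noteq> 0" using False pq by auto
    then have "degree p = Suc (degree q)" unfolding pq' using r0 by (subst degree_mult_eq) auto
    then have "degree q \<le> n" using Suc.prems(2) by simp
    moreover have "poly q z \<noteq> 0" if "cmod z < R" for z
      using Suc.prems(4)[OF that] pq' by (metis mult_zero_right poly_mult)
    ultimately have "cmod ((coeff q 1)\<^sup>2 - 2 * coeff q 2) \<le> real n / R\<^sup>2"
      using Suc.prems(1,3) c(1) by (intro Suc.IH) auto
    moreover have "cmod ((1 / r)\<^sup>2) \<le> 1 / R\<^sup>2"
    proof -
      have "R\<^sup>2 \<le> (cmod r)\<^sup>2" using \<open>cmod r \<ge> R\<close> \<open>R > 0\<close> by (intro power_mono) auto
      then have "1 / (cmod r)\<^sup>2 \<le> 1 / R\<^sup>2" using \<open>R > 0\<close> by (intro frac_le) auto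
      then show ?thesis by (simp add: norm_power norm_divide power_divide)
    qed
    moreover have "(coeff p 1)\<^sup>2 - 2 * coeff p 2 = ((coeff q 1)\<^sup>2 - 2 * coeff q 2) + (1 / r)\<^sup>2"
    proof -
      have "coeff q 0 = 1" using c(1) Suc.prems(1) by simp
      then show ?thesis unfolding c(2,3) using r0 by (simp add: power2_eq_square field_simps)
    qed
    ultimately show ?thesis using norm_triangle_ineq[of "(coeff q 1)\<^sup>2 - 2 * coeff q 2" "(1 / r)\<^sup>2"]
      by (simp add: add_divide_distrib)
  qed
qed

context complex_algebra
begin

text \<open>Split \<open>F = F1 + F2\<close> into its complex linear and antilinear parts. Multiplying \<open>b\<close> by unimodular scalars shows
  \<open>|F1 b| \<noteq> |F2 b|\<close> on \<open>G\<close>, hence \<open>|F2 b| < |F1 b|\<close> on the path component of \<open>1\<close>. If \<open>F1 x = 0\<close>, the polynomial \<open>F1 ((1 + z x)\<^sup>n)\<close>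
  has no zeros in a disc independent of \<open>n\<close>, and this bounds \<open>n (n - 1) F1 (x\<^sup>2)\<close> linearly in \<open>n\<close>. Once \<open>F1\<close> is
  multiplicative, \<open>F2 ((1 + z x)\<^sup>n)\<close> is bounded by \<open>1\<close>, which forces \<open>F2 = 0\<close>.\<close>

lemma real_linear_gleason_kahane_zelazko:
  fixes F :: "'a \<Rightarrow> complex" and G :: "'a set"
  assumes G: "open_subgroup_of_invertibles G" and F: "bounded_linear F"
    and F_1: "F 1 = 1" and F_i: "F (emb \<i>) = \<i>" and nz: "\<And>b. b \<in> G \<Longrightarrow> F b \<noteq> 0"
  shows "F (x * y) = F x * F y"
proof -
  note F_add = linear_add[OF bounded_linear.linear[OF F]]
  note F_scaleR = linear_scale[OF bounded_linear.linear[OF F]]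
  define F1 where "F1 x = (F x - \<i> * F (emb \<i> * x)) / 2" for x
  define F2 where "F2 x = (F x + \<i> * F (emb \<i> * x)) / 2" for x
  have F12: "F x = F1 x + F2 x" for x by (simp add: F1_def F2_def field_simps)
  have emb_split: "emb c * x = Re c *\<^sub>R x + Im c *\<^sub>R (emb \<i> * x)" for c x
  proof -
    have "emb c = emb (of_real (Re c) + of_real (Im c) * \<i>)" by (metis complex_eq mult.commute)
    then show ?thesis by (simp add: emb_add emb_mult emb_of_real distrib_right scaleR_conv_of_real mult.assoc)
  qed
  have F_emb: "F (emb c * x) = of_real (Re c) * F x + of_real (Im c) * F (emb \<i> * x)" for c x
    unfolding emb_split[of c] F_add F_scaleR by (simp add: scaleR_conv_of_real)
  have F_ii: "F (emb \<i> * (emb c * x)) = of_real (Re c) * F (emb \<i> * x) - of_real (Im c) * F x" for c x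
  proof -
    have "emb \<i> * (emb c * x) = emb (\<i> * c) * x" by (simp add: emb_mult mult.assoc)
    then show ?thesis using F_emb[of "\<i> * c" x] by simp
  qed
  have F1_emb: "F1 (emb c * x) = c * F1 x" for c x
    unfolding F1_def F_ii F_emb[of c] by (simp add: complex_eq_iff field_simps)
  have F2_emb: "F2 (emb c * x) = cnj c * F2 x" for c x
    unfolding F2_def F_ii F_emb[of c] by (simp add: complex_eq_iff field_simps)
  have F1_add: "F1 (x + y) = F1 x + F1 y" and F2_add: "F2 (x + y) = F2 x + F2 y" for x y
    by (simp_all add: F1_def F2_def distrib_left F_add algebra_simps add_divide_distrib diff_divide_distrib)
  have F1_1: "F1 1 = 1" and F2_1: "F2 1 = 0" by (simp_all add: F1_def F2_def F_1 F_i)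
  have F1_0: "F1 0 = 0" and F2_0: "F2 0 = 0" using F1_emb[of 0 0] F2_emb[of 0 0] by simp_all
  have F1_minus: "F1 (- x) = - F1 x" for x using F1_emb[of "- 1" x] by (simp add: emb_minus)
  have F1_diff: "F1 (x - y) = F1 x - F1 y" for x y using F1_add[of x "- y"] F1_minus by simp
  have F1_sum: "F1 (sum f I) = (\<Sum>k\<in>I. F1 (f k))" for f and I :: "nat set"
    by (induction I rule: infinite_finite_induct) (auto simp: F1_0 F1_add)
  have F2_sum: "F2 (sum f I) = (\<Sum>k\<in>I. F2 (f k))" for f and I :: "nat set"
    by (induction I rule: infinite_finite_induct) (auto simp: F2_0 F2_add)
  have F1_of_c: "F1 (emb c) = c" for c using F1_emb[of c 1] F1_1 by simp
  have F_ne: "cmod (F1 b) \<noteq> cmod (F2 b)" if b: "b \<in> G" for b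
  proof
    assume eq: "cmod (F1 b) = cmod (F2 b)"
    have "F1 b \<noteq> 0" using eq nz[OF b] F12[of b] by auto
    \<comment> \<open>With this unimodular \<open>c\<close>,
      \<open>c * F (c b) = c\<^sup>2 * F1 b + F2 b = 0\<close>, although \<open>c b\<close> lies in
      \<open>G\<close>.\<close>
    define c where "c = csqrt (- (F2 b / F1 b))"
    have "cmod (- (F2 b / F1 b)) = 1" using eq \<open>F1 b \<noteq> 0\<close> by (simp add: norm_divide flip: eq)
    then have cn: "cmod c = 1" unfolding c_def norm_csqrt by simp
    then have cc: "c * cnj c = 1" by (simp flip: complex_norm_square)
    have c2: "c * c = - (F2 b / F1 b)" unfolding c_def using power2_csqrt by (simp flip: power2_eq_square)
    have "c * F (emb c * b) = c * c * F1 b + c * cnj c * F2 b"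
      unfolding F12 F1_emb F2_emb by (simp add: algebra_simps)
    also have "\<dots> = 0" unfolding c2 cc using \<open>F1 b \<noteq> 0\<close> by simp
    finally have "F (emb c * b) = 0" using cn by auto
    moreover have "emb c * b \<in> G" using cn by (intro open_subgroup_mult[OF G] emb_in_open_subgroup[OF G] b) auto
    ultimately show False using nz by blast
  qed
  have F_less: "cmod (F2 ((1 + emb z * x) ^ n)) < cmod (F1 ((1 + emb z * x) ^ n))"
    if zx: "cmod z * norm x < 1" for z x n
  proof (rule ccontr)
    define p where "p t = (1 + emb (of_real t * z) * x) ^ n" for t :: real
    \<comment> \<open>If the claim failed, \<open>f\<close> would vanish somewhere by the
      intermediate value theorem, at a point \<open>p t\<close> of \<open>G\<close>.\<close>
    define f where "f t = cmod (F1 (p t)) - cmod (F2 (p t))" for t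
    assume "\<not> ?thesis"
    then have "f 1 \<le> 0" by (simp add: f_def p_def)
    moreover have "f 0 \<ge> 0" by (simp add: f_def p_def F1_1 F2_1)
    moreover have "continuous_on {0..1} f"
      unfolding f_def p_def F1_def F2_def
      by (intro continuous_intros bounded_linear.continuous_on[OF F]) auto
    ultimately obtain t where t: "0 \<le> t" "t \<le> 1" "f t = 0"
      using IVT2'[of f 1 0 0] by auto
    have "1 + emb (of_real t * z) * x \<in> G"
    proof -
      have "norm (emb (of_real t * z) * x) = t * (cmod z * norm x)"
        unfolding norm_emb_mult using t by (simp add: norm_mult)
      also have "\<dots> \<le> 1 * (cmod z * norm x)" using t by (intro mult_right_mono) auto
      finally have "norm (- (emb (of_real t * z) * x)) < 1" using zx by simp
      then show ?thesis using one_minus_in_open_subgroup[OF G, of "- (emb (of_real t * z) * x)"] by simp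
    qed
    then have "p t \<in> G" unfolding p_def
      by (induction n) (auto intro: open_subgroup_one[OF G] open_subgroup_mult[OF G])
    then show False using F_ne t(3) by (simp add: f_def)
  qed
  have expand: "(1 + emb z * x) ^ n = (\<Sum>k\<le>n. emb (z ^ k * of_nat (n choose k)) * x ^ k)" for z x n
    unfolding one_plus_power_eq_sum emb_mult_power
  proof (intro sum.cong refl)
    fix k
    have "emb (of_nat (n choose k)) = of_nat (n choose k)" using emb_of_real[of "real (n choose k)"] by simp
    then show "of_nat (n choose k) * (emb (z ^ k) * x ^ k) = emb (z ^ k * of_nat (n choose k)) * x ^ k"
      by (simp add: mult.commute[of "z ^ k"] emb_mult mult.assoc)
  qed
  have F1_sq0: "F1 (x ^ 2) = 0" if x: "F1 x = 0" for x
  proof (rule ccontr)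
    assume ne: "F1 (x ^ 2) \<noteq> 0"
    define R where "R = 1 / (norm x + 1)"
    have R: "R > 0" unfolding R_def by (simp add: add_nonneg_pos)
    obtain m :: nat where "real m > 1 / (R\<^sup>2 * cmod (F1 (x ^ 2)))" using reals_Archimedean2 by blast
    then have m: "real m * cmod (F1 (x ^ 2)) > 1 / R\<^sup>2" using ne R by (simp add: field_simps)
    \<comment> \<open>The root estimate becomes
      \<open>n * (n - 1) * |F1 (x\<^sup>2)| \<le> n / R\<^sup>2\<close>; after cancelling
      \<open>n\<close>, the choice of \<open>m\<close> contradicts it.\<close>
    define n where "n = m + 2"
    define a where "a k = of_nat (n choose k) * F1 (x ^ k)" for k
    define p where "p = (\<Sum>k\<le>n. monom (a k) k)"
    have cp: "coeff p k = (if k \<le> n then a k else 0)" for k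
      unfolding p_def by (simp add: coeff_sum)
    have deg: "degree p \<le> n" by (rule degree_le) (simp add: cp)
    have pp: "poly p z = F1 ((1 + emb z * x) ^ n)" for z
      unfolding expand F1_sum F1_emb p_def a_def by (simp add: poly_sum poly_monom ac_simps)
    have "cmod ((coeff p 1)\<^sup>2 - 2 * coeff p 2) \<le> real n / R\<^sup>2"
    proof (rule norm_sum_inverse_roots_squared_le[OF _ deg R])
      show "coeff p 0 = 1" by (simp add: cp a_def F1_1)
      fix z assume "cmod z < R"
      then have "cmod z * (norm x + 1) < 1" using norm_ge_zero[of x] by (simp add: R_def pos_less_divide_eq add_nonneg_pos)
      then have "cmod z * norm x < 1" using norm_ge_zero[of z] unfolding distrib_left by linarith
      from F_less[OF this, of n] show "poly p z \<noteq> 0" unfolding pp by auto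
    qed
    moreover have "coeff p 1 = 0" using x by (simp add: cp a_def n_def)
    moreover have "2 * coeff p 2 = of_nat (n * (n - 1)) * F1 (x ^ 2)"
    proof -
      have "2 * (n choose 2) = n * (n - 1)" using times_binomial_minus1_eq[of 2 n] by simp
      then have "2 * of_nat (n choose 2) = (of_nat (n * (n - 1)) :: complex)" by (metis of_nat_mult of_nat_numeral)
      then show ?thesis by (simp add: cp a_def n_def del: of_nat_mult flip: mult.assoc)
    qed
    ultimately have "real n * (real (n - 1) * cmod (F1 (x ^ 2))) \<le> real n * (1 / R\<^sup>2)"
      by (simp add: norm_mult)
    then have "real (n - 1) * cmod (F1 (x ^ 2)) \<le> 1 / R\<^sup>2" by (rule mult_left_le_imp_le) (simp add: n_def)
    moreover have "real m * cmod (F1 (x ^ 2)) \<le> real (n - 1) * cmod (F1 (x ^ 2))"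
      by (intro mult_right_mono) (simp_all add: n_def)
    ultimately show False using m by linarith
  qed
  have F1_sq: "F1 (x * x) = F1 x * F1 x" for x
  proof -
    let ?c = "F1 x"
    have "F1 (x - emb ?c) = 0" by (simp add: F1_diff F1_of_c)
    then have "F1 ((x - emb ?c) ^ 2) = 0" by (rule F1_sq0)
    moreover have "(x - emb ?c) ^ 2 = x * x - emb ?c * x - emb ?c * x + emb ?c * emb ?c"
      using emb_commutes[of ?c x] by (simp add: power2_eq_square algebra_simps)
    ultimately show ?thesis by (simp add: F1_diff F1_add F1_emb F1_of_c)
  qed
  have F1_jordan: "F1 (x * y + y * x) = 2 * F1 x * F1 y" for x y
  proof -
    have "F1 ((x + y) * (x + y)) = F1 (x * x) + F1 (x * y + y * x) + F1 (y * y)"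
      by (simp add: algebra_simps F1_add)
    then show ?thesis unfolding F1_sq F1_add by (simp add: algebra_simps)
  qed
  have F1_ideal: "F1 (x * y) = 0" if x: "F1 x = 0" for x y
  proof -
    let ?d = "x * y - y * x" and ?s = "x * y + y * x"
    have s: "F1 ?s = 0" using F1_jordan[of x y] x by simp
    \<comment> \<open>Zelazko's identity: a Jordan homomorphism into a field also kills the commutator.\<close>
    have "?d * ?d + ?s * ?s = (x * (y * x * y) + (y * x * y) * x) + (x * (y * x * y) + (y * x * y) * x)"
      by (simp add: algebra_simps)
    moreover have "F1 (x * (y * x * y) + (y * x * y) * x) = 0" using F1_jordan[of x "y * x * y"] x by simp
    ultimately have "F1 (?d * ?d) + F1 (?s * ?s) = 0" by (simp only: F1_add[symmetric]) (simp only: F1_add, simp)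
    then have "F1 ?d = 0" unfolding F1_sq using s by simp
    then show ?thesis using s by (simp add: F1_diff F1_add)
  qed
  have F1_mult: "F1 (x * y) = F1 x * F1 y" for x y
  proof -
    have "F1 ((x - emb (F1 x)) * y) = 0" by (rule F1_ideal) (simp add: F1_diff F1_of_c)
    then show ?thesis by (simp add: left_diff_distrib F1_diff F1_emb)
  qed
  have F1_power: "F1 (x ^ n) = F1 x ^ n" for x n by (induction n) (auto simp: F1_1 F1_mult)
  \<comment> \<open>Makes the Cauchy estimate available for scalar polynomials.\<close>
  interpret C: complex_algebra "(*) :: complex \<Rightarrow> complex \<Rightarrow> complex"
    by unfold_locales (auto simp: complex_normed_algebra_structure_def algebra_simps scaleR_conv_of_real norm_mult)
  have C_emb: "C.emb c = c" for c by (simp add: C.emb_def)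
  have F2_ker: "F2 x = 0" if x: "F1 x = 0" for x
  proof (rule ccontr)
    assume ne: "F2 x \<noteq> 0"
    define R where "R = 1 / (norm x + 1)"
    have R: "R > 0" unfolding R_def by (simp add: add_nonneg_pos)
    obtain m :: nat where "real m > 1 / (R * cmod (F2 x))" using reals_Archimedean2 by blast
    then have m: "R * (real m * cmod (F2 x)) > 1" using ne R by (simp add: field_simps)
    define n where "n = Suc m"
    \<comment> \<open>\<open>F2\<close> is antilinear, so it is the conjugate of
      \<open>F2 ((1 + z x)\<^sup>n)\<close> that is a polynomial in \<open>z\<close>.\<close>
    have "R * norm (of_nat (n choose 1) * cnj (F2 (x ^ 1))) \<le> 1"
    proof (rule C.cauchy_estimate_linear_coeff[where n = n and a = "\<lambda>k. of_nat (n choose k) * cnj (F2 (x ^ k))"])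
      fix z assume "cmod z = R"
      then have "cmod z * (norm x + 1) = 1" using norm_ge_zero[of x] by (simp add: R_def add_nonneg_eq_0_iff)
      then have "cmod z * norm x < 1" using \<open>cmod z = R\<close> R by (simp add: distrib_left)
      from F_less[OF this, of n] have "cmod (F2 ((1 + emb z * x) ^ n)) \<le> 1"
        by (simp add: F1_power F1_add F1_1 F1_emb x)
      moreover have "(\<Sum>k\<le>n. C.emb (z ^ k) * (of_nat (n choose k) * cnj (F2 (x ^ k)))) = cnj (F2 ((1 + emb z * x) ^ n))"
        unfolding expand F2_sum F2_emb by (simp add: C_emb mult.assoc)
      ultimately show "cmod (\<Sum>k\<le>n. C.emb (z ^ k) * (of_nat (n choose k) * cnj (F2 (x ^ k)))) \<le> 1" by simp
    qed (use R in \<open>auto simp: n_def\<close>)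
    then have "R * (real n * cmod (F2 x)) \<le> 1" by (simp add: norm_mult)
    moreover have "R * (real m * cmod (F2 x)) \<le> R * (real n * cmod (F2 x))"
      using R by (intro mult_left_mono mult_right_mono) (auto simp: n_def)
    ultimately show False using m by linarith
  qed
  have "F2 x = 0" for x
  proof -
    have "F2 ((x - emb (F1 x)) + emb (F1 x) * 1) = F2 (x - emb (F1 x)) + cnj (F1 x) * F2 1"
      by (simp only: F2_add F2_emb)
    moreover have "F2 (x - emb (F1 x)) = 0" by (rule F2_ker) (simp add: F1_diff F1_of_c)
    ultimately show ?thesis using F2_1 by simp
  qed
  then show ?thesis using F12 F1_mult by simp
qed

end

section \<open>Isometries between open subgroups\<close>

text \<open>Additivity gives homogeneity for integers. Rounding \<open>n t\<close> to an integer
  bounds \<open>n\<close> times the defect at \<open>t\<close> by \<open>2 * norm x\<close> for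
  every \<open>n\<close>.\<close>

lemma additive_isometry_linear:
  fixes S :: "'a::real_normed_vector \<Rightarrow> 'b::real_normed_vector"
  assumes add: "\<And>x y. S (x + y) = S x + S y" and norm: "\<And>x. norm (S x) = norm x"
  shows "linear S"
proof (rule linearI)
  show "S (x + y) = S x + S y" for x y by (rule add)
  have S0: "S 0 = 0" using add[of 0 0] by simp
  have S_nat: "S (real n *\<^sub>R x) = real n *\<^sub>R S x" for n x
    by (induction n) (simp_all add: S0 add scaleR_add_left)
  have S_minus: "S (- x) = - S x" for x using add[of x "- x"] S0 by (simp add: eq_neg_iff_add_eq_0 add.commute)
  have S_int: "S (of_int k *\<^sub>R x) = of_int k *\<^sub>R S x" for k x
    using S_nat S_minus by (cases k rule: int_cases2) simp_all
  fix t x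
  show "S (t *\<^sub>R x) = t *\<^sub>R S x"
  proof (rule ccontr)
    assume ne: "S (t *\<^sub>R x) \<noteq> t *\<^sub>R S x"
    obtain n :: nat where "real n > 2 * norm x / norm (S (t *\<^sub>R x) - t *\<^sub>R S x)" using reals_Archimedean2 by blast
    then have n: "real n * norm (S (t *\<^sub>R x) - t *\<^sub>R S x) > 2 * norm x" using ne by (simp add: field_simps)
    define k where "k = \<lfloor>real n * t\<rfloor>"
    define e where "e = real n * t - of_int k"
    have e: "\<bar>e\<bar> \<le> 1" unfolding e_def k_def by linarith
    have "real n *\<^sub>R (S (t *\<^sub>R x) - t *\<^sub>R S x) = S ((real n * t) *\<^sub>R x) - (real n * t) *\<^sub>R S x"
      by (simp add: scaleR_diff_right flip: S_nat)
    also have "real n * t = of_int k + e" by (simp add: e_def)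
    also have "S ((of_int k + e) *\<^sub>R x) - (of_int k + e) *\<^sub>R S x = S (e *\<^sub>R x) - e *\<^sub>R S x"
      by (simp add: scaleR_add_left add S_int)
    finally have "real n * norm (S (t *\<^sub>R x) - t *\<^sub>R S x) = norm (S (e *\<^sub>R x) - e *\<^sub>R S x)"
      by (metis norm_scaleR abs_of_nat)
    also have "\<dots> \<le> norm (S (e *\<^sub>R x)) + norm (e *\<^sub>R S x)" by (rule norm_triangle_ineq4)
    also have "\<dots> = 2 * (\<bar>e\<bar> * norm x)" by (simp add: norm)
    also have "\<dots> \<le> 2 * (1 * norm x)" using e by (intro mult_left_mono mult_right_mono) auto
    finally show False using n by simp
  qed
qed

context complex_algebra
begin

lemma open_subgroup_isometry_affine:
  fixes T :: "'a \<Rightarrow> 'b::banach" and G :: "'a set"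
  assumes G: "open_subgroup_of_invertibles G"
    and iso: "\<And>f g. f \<in> G \<Longrightarrow> g \<in> G \<Longrightarrow> norm (T f - T g) = norm (f - g)"
    and open_image: "open (T ` G)"
  obtains S u where "linear S" "surj S" "\<And>x. norm (S x) = norm x" "\<And>f. f \<in> G \<Longrightarrow> T f = S f + u"
proof -
  note openG = open_subgroup_open[OF G]
  have T_cont: "isCont T f" if "f \<in> G" for f
  proof -
    have "continuous_on G T" unfolding continuous_on_iff dist_norm using iso by metis
    then show ?thesis using openG that by (simp add: continuous_on_eq_continuous_at)
  qed
  have scale: "r *\<^sub>R f \<in> G" if "r > 0" "f \<in> G" for r f
    using open_subgroup_mult[OF G emb_in_open_subgroup[OF G, of "of_real r"] that(2)] that(1)
    by (simp add: emb_of_real scaleR_conv_of_real)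
  define \<epsilon> where "\<epsilon> n = inverse (real (Suc n))" for n
  have eps: "\<epsilon> \<longlonglongrightarrow> 0" "\<And>n. \<epsilon> n > 0" unfolding \<epsilon>_def using LIMSEQ_inverse_real_of_nat by auto
  have epsG: "\<epsilon> n *\<^sub>R f \<in> G" if "f \<in> G" for n f using scale eps that by blast
  \<comment> \<open>\<open>0\<close> is not in \<open>G\<close>; completeness of the target supplies
    the missing value of \<open>T\<close> there.\<close>
  have "Cauchy (\<lambda>n. T (\<epsilon> n *\<^sub>R 1))"
  proof (rule metric_CauchyI)
    fix e :: real assume "e > 0"
    then obtain M where M: "\<And>m n. m \<ge> M \<Longrightarrow> n \<ge> M \<Longrightarrow> dist (\<epsilon> m) (\<epsilon> n) < e"
      using LIMSEQ_imp_Cauchy[OF eps(1)] unfolding Cauchy_def by blast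
    have "dist (T (\<epsilon> m *\<^sub>R 1)) (T (\<epsilon> n *\<^sub>R 1)) = dist (\<epsilon> m) (\<epsilon> n)" for m n
      unfolding dist_norm using iso[OF epsG epsG] open_subgroup_one[OF G]
      by (simp flip: scaleR_diff_left)
    then show "\<exists>M. \<forall>m\<ge>M. \<forall>n\<ge>M. dist (T (\<epsilon> m *\<^sub>R 1)) (T (\<epsilon> n *\<^sub>R 1)) < e"
      using M by (intro exI[of _ M]) simp
  qed
  then obtain u where u: "(\<lambda>n. T (\<epsilon> n *\<^sub>R 1)) \<longlonglongrightarrow> u" using Cauchy_convergent convergent_def by blast
  have lim: "(\<lambda>n. T (\<epsilon> n *\<^sub>R f)) \<longlonglongrightarrow> u" if f: "f \<in> G" for f
  proof -
    have "norm (T (\<epsilon> n *\<^sub>R f) - T (\<epsilon> n *\<^sub>R 1)) = \<epsilon> n * norm (f - 1)" for n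
      using iso[OF epsG[OF f] epsG[OF open_subgroup_one[OF G]]] eps(2)[of n]
      by (simp flip: scaleR_diff_right)
    then have "(\<lambda>n. norm (T (\<epsilon> n *\<^sub>R f) - T (\<epsilon> n *\<^sub>R 1))) \<longlonglongrightarrow> 0"
      using tendsto_mult_left_zero[OF eps(1)] by (simp only:)
    then show ?thesis by (rule Lim_transform[OF u tendsto_norm_zero_cancel])
  qed
  have mid: "T ((1/2) *\<^sub>R (f + g)) = (1/2) *\<^sub>R (T f + T g)" if "closed_segment f g \<subseteq> G" for f g
    using isometry_midpoint_segment[OF _ openG open_image that] iso by (simp add: dist_norm)
  have half: "T ((1/2) *\<^sub>R f) = (1/2) *\<^sub>R (T f + u)" if f: "f \<in> G" for f
  proof -
    \<comment> \<open>Rays stay in \<open>G\<close>, so the midpoint rule holds between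
      \<open>f\<close> and points tending to \<open>0\<close>.\<close>
    have "T ((1/2) *\<^sub>R (f + \<epsilon> n *\<^sub>R f)) = (1/2) *\<^sub>R (T f + T (\<epsilon> n *\<^sub>R f))" for n
    proof (rule mid, rule subsetI)
      fix g assume "g \<in> closed_segment f (\<epsilon> n *\<^sub>R f)"
      then obtain t where t: "0 \<le> t" "t \<le> 1" "g = (1 - t) *\<^sub>R f + t *\<^sub>R (\<epsilon> n *\<^sub>R f)"
        unfolding closed_segment_def by auto
      then have "g = ((1 - t) + t * \<epsilon> n) *\<^sub>R f" by (simp add: scaleR_add_left)
      moreover have "(1 - t) + t * \<epsilon> n > 0"
        using t eps(2)[of n] by (cases "t = 1") (auto intro: add_pos_nonneg)
      ultimately show "g \<in> G" using scale f by blast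
    qed
    moreover have "(\<lambda>n. (1/2) *\<^sub>R (T f + T (\<epsilon> n *\<^sub>R f))) \<longlonglongrightarrow> (1/2) *\<^sub>R (T f + u)"
      by (intro tendsto_intros lim f)
    moreover have "(\<lambda>n. T ((1/2) *\<^sub>R (f + \<epsilon> n *\<^sub>R f))) \<longlonglongrightarrow> T ((1/2) *\<^sub>R (f + 0 *\<^sub>R f))"
      using scale[of "1/2"] f by (intro isCont_tendsto_compose[OF T_cont] tendsto_intros eps) auto
    ultimately show ?thesis using LIMSEQ_unique by fastforce
  qed
  define T0 where "T0 f = T f - u" for f
  have T0_iso: "norm (T0 f - T0 g) = norm (f - g)" if "f \<in> G" "g \<in> G" for f g
    using iso that by (simp add: T0_def)
  have T0_add: "T0 (f + g) = T0 f + T0 g" if seg: "closed_segment f g \<subseteq> G" for f g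
  proof -
    have "(1/2) *\<^sub>R (f + g) = (1 - 1/2) *\<^sub>R f + (1/2) *\<^sub>R g" by (simp add: scaleR_add_right)
    then have "(1/2) *\<^sub>R (f + g) \<in> closed_segment f g" unfolding closed_segment_def by (intro CollectI exI[of _ "1/2"]) auto
    then have "(1/2) *\<^sub>R (f + g) \<in> G" using seg by blast
    from scale[OF _ this, of 2] have "f + g \<in> G" by simp
    then have "(1/2) *\<^sub>R (T (f + g) + u) = (1/2) *\<^sub>R (T f + T g)" using half mid[OF seg] by metis
    then have "T (f + g) + u = T f + T g" by simp
    then show ?thesis by (simp add: T0_def algebra_simps)
  qed
  \<comment> \<open>The union of the balls of radius \<open>r\<close> about positive reals
    \<open>r\<close>: a convex cone inside \<open>G\<close>.\<close>
  define \<Omega> where "\<Omega> = {x :: 'a. \<exists>r. norm (x - of_real r) < r}"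
  have \<Omega>_G: "x \<in> G" if x: "x \<in> \<Omega>" for x
  proof -
    obtain r where r: "norm (x - of_real r) < r" using x unfolding \<Omega>_def by blast
    then have "norm (x - of_real r) < cmod (of_real r)" using norm_ge_zero[of "x - of_real r"] by simp
    from emb_add_in_open_subgroup[OF G this] show ?thesis by (simp add: emb_of_real)
  qed
  have \<Omega>_seg: "closed_segment x y \<subseteq> G" if xy: "x \<in> \<Omega>" "y \<in> \<Omega>" for x y
  proof
    obtain r s where rs: "norm (x - of_real r) < r" "norm (y - of_real s) < s" using xy unfolding \<Omega>_def by blast
    fix g assume "g \<in> closed_segment x y"
    then obtain t where t: "0 \<le> t" "t \<le> 1" "g = (1 - t) *\<^sub>R x + t *\<^sub>R y" unfolding closed_segment_def by auto
    have "g - of_real ((1 - t) * r + t * s) = (1 - t) *\<^sub>R (x - of_real r) + t *\<^sub>R (y - of_real s)"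
      unfolding t(3) by (simp add: scaleR_conv_of_real right_diff_distrib)
    then have "norm (g - of_real ((1 - t) * r + t * s)) \<le> (1 - t) * norm (x - of_real r) + t * norm (y - of_real s)"
      using norm_triangle_ineq[of "(1 - t) *\<^sub>R (x - of_real r)" "t *\<^sub>R (y - of_real s)"] t by simp
    also have "\<dots> < (1 - t) * r + t * s"
    proof (cases "t = 1")
      case False
      then have "(1 - t) * norm (x - of_real r) < (1 - t) * r" using t rs by (intro mult_strict_left_mono) auto
      moreover have "t * norm (y - of_real s) \<le> t * s" using t rs by (intro mult_left_mono) auto
      ultimately show ?thesis by linarith
    qed (use rs in simp)
    finally have "g \<in> \<Omega>" unfolding \<Omega>_def by blast
    then show "g \<in> G" by (rule \<Omega>_G)
  qed
  have \<Omega>_add: "T0 (x + y) = T0 x + T0 y" if "x \<in> \<Omega>" "y \<in> \<Omega>" for x y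
    using T0_add \<Omega>_seg that by blast
  have \<Omega>_real: "of_real r \<in> \<Omega>" if "r > 0" for r
    unfolding \<Omega>_def using that by (intro CollectI exI[of _ r]) simp
  have \<Omega>_shift: "x + of_real r \<in> \<Omega>" if "norm x < r" for x r
    unfolding \<Omega>_def using that by (intro CollectI exI[of _ r]) simp
  \<comment> \<open>Any large real shift moves \<open>x\<close> into \<open>\<Omega>\<close>;
    \<open>S_eq\<close> shows that its size does not matter.\<close>
  define S where "S x = T0 (x + of_real (norm x + 1)) - T0 (of_real (norm x + 1))" for x
  have S_eq: "S x = T0 (x + of_real r) - T0 (of_real r)" if r: "norm x < r" for x r
  proof -
    let ?s = "norm x + 1"
    have s: "?s > 0" by (simp add: add_nonneg_pos)
    have r0: "r > 0" using r norm_ge_zero[of x] by linarith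
    have "T0 (x + of_real r) + T0 (of_real ?s) = T0 (x + of_real r + of_real ?s)"
      using \<Omega>_add[OF \<Omega>_shift[OF r] \<Omega>_real[OF s]] by simp
    also have "x + of_real r + of_real ?s = x + of_real ?s + of_real r" by (simp add: ac_simps)
    also have "T0 \<dots> = T0 (x + of_real ?s) + T0 (of_real r)"
      using \<Omega>_add[OF \<Omega>_shift[of x ?s] \<Omega>_real[OF r0]] by simp
    finally show ?thesis unfolding S_def by (simp add: algebra_simps)
  qed
  have S_add: "S (x + y) = S x + S y" for x y
  proof -
    define r where "r = norm x + 1"
    define s where "s = norm y + 1"
    have rs: "norm x < r" "norm y < s" "r > 0" "s > 0" unfolding r_def s_def by (simp_all add: add_nonneg_pos)
    have "norm (x + y) < r + s" using norm_triangle_ineq[of x y] rs by linarith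
    then have "S (x + y) = T0 (x + y + of_real (r + s)) - T0 (of_real (r + s))" by (rule S_eq)
    also have "x + y + of_real (r + s) = (x + of_real r) + (y + of_real s)" by simp
    also have "T0 \<dots> = T0 (x + of_real r) + T0 (y + of_real s)" using rs by (intro \<Omega>_add \<Omega>_shift)
    also have "T0 (of_real (r + s)) = T0 (of_real r) + T0 (of_real s)" using rs by (simp add: \<Omega>_add \<Omega>_real)
    finally show ?thesis using S_eq rs by simp
  qed
  have S_norm: "norm (S x) = norm x" for x
  proof -
    have "norm x + 1 > 0" "norm x < norm x + 1" by (simp_all add: add_nonneg_pos)
    then show ?thesis unfolding S_def by (subst T0_iso) (auto intro!: \<Omega>_G \<Omega>_real \<Omega>_shift simp del: of_real_add)
  qed
  have S_lin: "linear S" by (rule additive_isometry_linear[OF S_add S_norm])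
  have S_\<Omega>: "T0 x = S x" if "x \<in> \<Omega>" for x
  proof -
    have "norm x + 1 > 0" by (simp add: add_nonneg_pos)
    then have "T0 (x + of_real (norm x + 1)) = T0 x + T0 (of_real (norm x + 1))" by (intro \<Omega>_add that \<Omega>_real)
    then show ?thesis unfolding S_def by (simp only: add_diff_cancel_right')
  qed
  have one_\<Omega>: "1 \<in> \<Omega>" using \<Omega>_real[of 1] by simp
  have "surj S"
  proof -
    obtain e where e: "e > 0" "ball (T 1) e \<subseteq> T ` G"
      using open_image open_subgroup_one[OF G] by (meson imageI open_contains_ball)
    \<comment> \<open>Below \<open>e\<close> the point \<open>T 1 + y\<close> has a preimage in
      \<open>G\<close>; below \<open>1\<close> this preimage lies in
      \<open>\<Omega>\<close>.\<close>
    have small: "y \<in> range S" if y: "norm y < min e 1" for y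
    proof -
      have "T 1 + y \<in> ball (T 1) e" using y by (simp add: dist_norm)
      then obtain f where f: "f \<in> G" "T 1 + y = T f" using e by blast
      then have "norm (f - 1) = norm y" using iso[OF f(1) open_subgroup_one[OF G]] by (simp flip: f(2))
      then have "f \<in> \<Omega>" unfolding \<Omega>_def using y by (intro CollectI exI[of _ 1]) simp
      then have "S f - S 1 = y" using S_\<Omega> one_\<Omega> f(2) by (simp add: T0_def algebra_simps flip: S_\<Omega>)
      then have "S (f - 1) = y" using linear_diff[OF S_lin] by simp
      then show ?thesis by blast
    qed
    have "y \<in> range S" for y
    proof -
      define c where "c = min e 1 / (norm y + 1)"
      have ny: "norm y + 1 > 0" by (simp add: add_nonneg_pos)
      have c: "c > 0" unfolding c_def using e ny by simp
      have "c * norm y < c * (norm y + 1)" using c by simp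
      also have "\<dots> = min e 1" unfolding c_def using ny by simp
      finally have "norm (c *\<^sub>R y) < min e 1" using c by simp
      then obtain x where x: "c *\<^sub>R y = S x" using small by blast
      have "S ((1 / c) *\<^sub>R x) = (1 / c) *\<^sub>R (c *\<^sub>R y)" unfolding x by (rule linear_scale[OF S_lin])
      also have "\<dots> = y" using c by simp
      finally show ?thesis by blast
    qed
    then show ?thesis by blast
  qed
  \<comment> \<open>Starting on \<open>\<Omega>\<close>, the identity \<open>T0 = S\<close> is carried along chains of segments inside \<open>G\<close> to every \<open>c + f\<close> with \<open>norm f < |c|\<close>.\<close>
  have cone_step: "T0 (emb c + f) = S (emb c + f) \<and> norm f < cmod (c + w)"
    if f: "norm f < cmod c" and w: "w \<noteq> 0" "Re (w * cnj c) \<ge> 0" "T0 (emb w) = S (emb w)"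
      and cw: "norm f < cmod (c + w) \<Longrightarrow> T0 (emb (c + w) + f) = S (emb (c + w) + f)" for c w f
  proof -
    \<comment> \<open>The angle between \<open>c\<close> and \<open>w\<close> is at most a right
      angle, so adding a multiple of \<open>w\<close> does not shorten \<open>c\<close>.\<close>
    have ge: "a * cmod c \<le> cmod (of_real a * c + of_real b * w)" if "a \<ge> 0" "b \<ge> 0" for a b
    proof (rule power2_le_imp_le)
      have "(cmod (of_real a * c + of_real b * w))\<^sup>2
        = (a * cmod c)\<^sup>2 + 2 * a * b * Re (w * cnj c) + (b * cmod w)\<^sup>2"
        unfolding power_mult_distrib cmod_power2 by (simp add: power2_eq_square algebra_simps)
      moreover have "2 * a * b * Re (w * cnj c) \<ge> 0" using that w by (intro mult_nonneg_nonneg) auto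
      ultimately show "(a * cmod c)\<^sup>2 \<le> (cmod (of_real a * c + of_real b * w))\<^sup>2" by simp
    qed simp
    have cw': "norm f < cmod (c + w)" using ge[of 1 1] f by simp
    have "closed_segment (emb c + f) (emb w) \<subseteq> G"
    proof
      fix g assume "g \<in> closed_segment (emb c + f) (emb w)"
      then obtain t where t: "0 \<le> t" "t \<le> 1" "g = (1 - t) *\<^sub>R (emb c + f) + t *\<^sub>R emb w"
        unfolding closed_segment_def by auto
      have g: "g = emb (of_real (1 - t) * c + of_real t * w) + (1 - t) *\<^sub>R f"
        unfolding t(3) by (simp add: emb_add emb_mult emb_of_real scaleR_conv_of_real distrib_left del: of_real_diff)
      have "norm ((1 - t) *\<^sub>R f) < cmod (of_real (1 - t) * c + of_real t * w)"
      proof (cases "t = 1")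
        case False
        then have "(1 - t) * norm f < (1 - t) * cmod c" using t f by (intro mult_strict_left_mono) auto
        then show ?thesis using ge[of "1 - t" t] t by simp
      qed (use w in simp)
      then show "g \<in> G" unfolding g by (rule emb_add_in_open_subgroup[OF G])
    qed
    then have "T0 ((emb c + f) + emb w) = T0 (emb c + f) + T0 (emb w)" by (rule T0_add)
    moreover have "(emb c + f) + emb w = emb (c + w) + f" by (simp add: emb_add)
    ultimately have "T0 (emb c + f) + S (emb w) = S (emb c + f) + S (emb w)"
      using cw[OF cw'] w(3) S_add[of "emb c + f" "emb w"] by metis
    then show ?thesis using cw' by simp
  qed
  have right: "T0 (emb c + f) = S (emb c + f)" if f: "norm f < cmod c" and c: "Re c \<ge> 0" for c f
  proof -
    define s where "s = norm (emb c + f) + 1"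
    have s: "s > 0" "norm (emb c + f) < s" unfolding s_def by (simp_all add: add_nonneg_pos)
    have "emb (c + of_real s) + f = (emb c + f) + of_real s" by (simp add: emb_add emb_of_real)
    then have "T0 (emb (c + of_real s) + f) = S (emb (c + of_real s) + f)" using S_\<Omega>[OF \<Omega>_shift[OF s(2)]] by (simp only:)
    moreover have "T0 (emb (of_real s)) = S (emb (of_real s))" unfolding emb_of_real using S_\<Omega>[OF \<Omega>_real[OF s(1)]] .
    moreover have "complex_of_real s \<noteq> 0" "Re (of_real s * cnj c) \<ge> 0" using s c by simp_all
    ultimately show ?thesis using cone_step[OF f] by blast
  qed
  have right_scalar: "T0 (emb w) = S (emb w)" if "w \<noteq> 0" "Re w \<ge> 0" for w
    using right[of 0 w] that by simp
  have nonreal: "T0 (emb c + f) = S (emb c + f)" if f: "norm f < cmod c" and c: "Re c < 0" "Im c \<noteq> 0" for c f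
  proof -
    \<comment> \<open>Perpendicular to \<open>c\<close>, and scaled so that \<open>c + w\<close> is
      on the imaginary axis.\<close>
    define w where "w = \<i> * of_real (Re c / Im c) * c"
    have "w \<noteq> 0" using c unfolding w_def by auto
    moreover have "Re w \<ge> 0" "Re (w * cnj c) \<ge> 0" "Re (c + w) \<ge> 0"
      unfolding w_def using c by (simp_all add: field_simps)
    ultimately show ?thesis using cone_step[OF f, of w] right_scalar right by blast
  qed
  have all: "T0 (emb c + f) = S (emb c + f)" if f: "norm f < cmod c" for c f
  proof (cases "Re c \<ge> 0 \<or> Im c \<noteq> 0")
    case True
    then show ?thesis using right nonreal f by force
  next
    case False
    \<comment> \<open>Here \<open>c\<close> is a negative real; a perpendicular step leads to the
      case \<open>nonreal\<close>.\<close>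
    define w where "w = - \<i> * c"
    have "w \<noteq> 0" "Re w \<ge> 0" "Re (w * cnj c) \<ge> 0" "Re (c + w) < 0" "Im (c + w) \<noteq> 0"
      using False unfolding w_def by (auto simp: complex_eq_iff)
    then show ?thesis using cone_step[OF f, of w] right_scalar nonreal by blast
  qed
  have "T0 f = S f" if f: "f \<in> G" for f
  proof -
    obtain f' where f': "T0 f = S f'" using \<open>surj S\<close> by (metis surjD)
    \<comment> \<open>No segment need join \<open>f\<close> to \<open>\<Omega>\<close> inside \<open>G\<close>, so \<open>f\<close> is compared with \<open>f + c\<close> for all large complex \<open>c\<close> instead.\<close>
    have far: "norm ((f' - f) - emb c) = cmod c" if c: "norm f < cmod c" for c
    proof -
      have "emb c + f \<in> G" by (rule emb_add_in_open_subgroup[OF G c])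
      then have "norm (T0 f - T0 (emb c + f)) = cmod c" using T0_iso[OF f] by simp
      then have "norm (S f' - S (emb c + f)) = cmod c" using f' all[OF c] by simp
      then have "norm (S (f' - (emb c + f))) = cmod c" using linear_diff[OF S_lin] by simp
      then show ?thesis by (simp add: S_norm algebra_simps)
    qed
    \<comment> \<open>For \<open>|z| = R\<close> the scalar \<open>c = - 1 / z\<close> has modulus
      \<open>norm f + 1\<close>, large enough for \<open>far\<close>, and
      \<open>1 + z d = z (d - c)\<close> with \<open>d = f' - f\<close>.\<close>
    define R where "R = 1 / (norm f + 1)"
    have nf: "norm f + 1 > 0" by (simp add: add_nonneg_pos)
    have "f' - f = 0"
    proof (rule eq_zero_if_norm_one_plus_le)
      show "R > 0" unfolding R_def using nf by simp
      fix z assume z: "cmod z = R"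
      then have "z \<noteq> 0" using \<open>R > 0\<close> by auto
      have c: "cmod (- 1 / z) = norm f + 1" using z nf by (simp add: norm_divide R_def)
      have "1 + emb z * (f' - f) = emb z * ((f' - f) - emb (- 1 / z))"
      proof -
        have e: "emb z * emb (- 1 / z) = - 1" using \<open>z \<noteq> 0\<close> by (simp add: emb_minus flip: emb_mult)
        show ?thesis unfolding right_diff_distrib[of "emb z" "f' - f"] e by simp
      qed
      then have "norm (1 + emb z * (f' - f)) = R * (norm f + 1)"
        using far[of "- 1 / z"] c z by (simp add: norm_emb_mult)
      then show "norm (1 + emb z * (f' - f)) \<le> 1" using nf by (simp add: R_def)
    qed
    then show ?thesis using f' by simp
  qed
  then have "T f = S f + u" if "f \<in> G" for f using that by (simp add: T0_def algebra_simps)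
  then show thesis using that S_lin \<open>surj S\<close> S_norm by blast
qed

end

text \<open>The map goes from \<open>B\<close> to \<open>A\<close> because multiplicativity is
  tested with characters of the target, and \<open>A\<close> is the algebra known to be commutative
  and semisimple.\<close>

lemma normalized_isometry_multiplicative:
  fixes csA :: "complex \<Rightarrow> 'a::{real_normed_algebra_1, banach} \<Rightarrow> 'a"
    and csB :: "complex \<Rightarrow> 'b::{real_normed_algebra_1, banach} \<Rightarrow> 'b"
    and V :: "'b \<Rightarrow> 'a" and GA :: "'a set" and GB :: "'b set"
  assumes csA: "complex_normed_algebra_structure csA" and csB: "complex_normed_algebra_structure csB"
    and comm: "\<And>a b :: 'a. a * b = b * a" and semisimple: "(jacobson_radical :: 'a set) = {0}"
    and GA: "open_subgroup_of_invertibles GA" and GB: "open_subgroup_of_invertibles GB"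
    and V: "linear V" "surj V" "\<And>y. norm (V y) = norm y" and V_GB: "\<And>y. y \<in> GB \<Longrightarrow> V y \<in> GA"
  defines "\<Psi> \<equiv> \<lambda>y. ring_inverse (V 1) * V y"
  shows "\<Psi> (x * y) = \<Psi> x * \<Psi> y"
proof -
  interpret A: complex_algebra csA by unfold_locales (rule csA)
  interpret B: complex_algebra csB by unfold_locales (rule csB)
  define a where "a = V 1"
  have aG: "a \<in> GA" unfolding a_def by (intro V_GB open_subgroup_one[OF GB])
  have ai: "a \<in> invertibles" by (rule open_subgroup_invertible[OF GA aG])
  define i where "i = ring_inverse a"
  have ia: "i * a = 1" unfolding i_def by (rule ring_inverse_left[OF ai])
  have \<Psi>: "\<Psi> z = i * V z" for z unfolding \<Psi>_def i_def a_def ..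
  have \<Psi>_GB: "\<Psi> z \<in> GA" if "z \<in> GB" for z
    unfolding \<Psi> i_def by (intro open_subgroup_mult[OF GA] open_subgroup_inverse[OF GA] aG V_GB that)
  have "\<Psi> (x * y) - \<Psi> x * \<Psi> y \<in> jacobson_radical"
  proof (rule ccontr)
    assume "\<not> ?thesis"
    then obtain M where M: "maximal_left_ideal M" "\<Psi> (x * y) - \<Psi> x * \<Psi> y \<notin> M"
      unfolding jacobson_radical_def by blast
    show False
    proof (rule A.character_exists[OF comm M])
      fix \<phi> :: "'a \<Rightarrow> complex"
      assume add: "\<And>x y. \<phi> (x + y) = \<phi> x + \<phi> y"
        and mult: "\<And>x y. \<phi> (x * y) = \<phi> x * \<phi> y" and emb: "\<And>c. \<phi> (A.emb c) = c"
        and bound: "\<And>x. cmod (\<phi> x) \<le> norm x" and ne: "\<phi> (\<Psi> (x * y) - \<Psi> x * \<Psi> y) \<noteq> 0"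
      have \<phi>_emb: "\<phi> (A.emb c * z) = c * \<phi> z" for c z by (simp add: mult emb)
      have \<phi>_minus: "\<phi> (- z) = - \<phi> z" for z using \<phi>_emb[of "- 1" z] by (simp add: A.emb_minus)
      have \<phi>_diff: "\<phi> (z - w) = \<phi> z - \<phi> w" for z w using add[of z "- w"] \<phi>_minus by simp
      have \<phi>_1: "\<phi> 1 = 1" using emb[of 1] by simp
      have \<phi>_scaleR: "\<phi> (r *\<^sub>R z) = r *\<^sub>R \<phi> z" for r z
        using \<phi>_emb[of "of_real r" z] by (simp add: A.emb_of_real scaleR_conv_of_real)
      have \<phi>_ne: "\<phi> g \<noteq> 0" if "g \<in> GA" for g
        using mult[of g "ring_inverse g"] ring_inverse_right[OF open_subgroup_invertible[OF GA that]] \<phi>_1 by auto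
      \<comment> \<open>Every point at distance less than \<open>1\<close> from a unimodular scalar lies in \<open>GB\<close>, so \<open>V\<close> of the scalar has spectrum in the circle.\<close>
      have unimodular: "cmod (\<phi> (V (B.emb c))) = 1" if c: "cmod c = 1" for c
      proof (rule ccontr)
        let ?y = "V (B.emb c)"
        assume "cmod (\<phi> ?y) \<noteq> 1"
        then have lt: "cmod (\<phi> ?y) < 1" using bound[of ?y] c V(3) by simp
        obtain w where w: "V w = A.emb (\<phi> ?y)" using V(2) by (metis surjD)
        have "norm (- w) < cmod c" using lt c V(3)[of w] w by simp
        then have "B.emb c + - w \<in> GB" by (rule B.emb_add_in_open_subgroup[OF GB])
        then have "V (B.emb c + - w) \<in> GA" by (rule V_GB)
        then have "\<phi> (?y - A.emb (\<phi> ?y)) \<noteq> 0" using \<phi>_ne linear_diff[OF V(1)] w by simp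
        then show False by (simp add: \<phi>_diff emb)
      qed
      define p where "p = \<phi> a"
      define q where "q = \<phi> (V (B.emb \<i>))"
      have V_emb: "\<phi> (V (B.emb c)) = Re c *\<^sub>R p + Im c *\<^sub>R q" for c
      proof -
        have "c = Re c *\<^sub>R 1 + Im c *\<^sub>R \<i>" by (simp add: complex_eq_iff)
        then have "B.emb c = B.emb (Re c *\<^sub>R 1 + Im c *\<^sub>R \<i>)" by (rule arg_cong)
        then have "B.emb c = Re c *\<^sub>R 1 + Im c *\<^sub>R B.emb \<i>" unfolding B.emb_add B.emb_scaleR by simp
        then show ?thesis
          unfolding p_def q_def a_def by (simp add: linear_add[OF V(1)] linear_scale[OF V(1)] add \<phi>_scaleR)
      qed
      have p: "cmod p = 1" using unimodular[of 1] by (simp add: p_def a_def)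
      have q: "cmod q = 1" using unimodular[of \<i>] by (simp add: q_def)
      \<comment> \<open>The unimodular scalar \<open>(1 + \<i>) / sqrt 2\<close> shows that
        \<open>p\<close> and \<open>q\<close> are perpendicular, whence \<open>q / p\<close> is
        \<open>\<i>\<close> or \<open>- \<i>\<close>.\<close>
      have pq: "cmod (p + q) = sqrt 2"
      proof -
        have "cmod (Complex (1 / sqrt 2) (1 / sqrt 2)) = 1" by (simp add: cmod_def power_divide)
        from unimodular[OF this] have "cmod ((1 / sqrt 2) *\<^sub>R (p + q)) = 1" by (simp add: V_emb scaleR_add_right)
        then show ?thesis by (simp add: divide_simps)
      qed
      define t where "t = q / p"
      have p0: "p \<noteq> 0" using p by auto
      have t: "cmod t = 1" unfolding t_def using p q by (simp add: norm_divide)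
      have "1 + t = (p + q) / p" unfolding t_def using p0 by (simp add: field_simps)
      then have "(cmod (1 + t))\<^sup>2 = 2" using p pq by (simp add: norm_divide)
      then have t1: "(1 + Re t)\<^sup>2 + (Im t)\<^sup>2 = 2" by (simp add: cmod_power2)
      have t2: "(Re t)\<^sup>2 + (Im t)\<^sup>2 = 1" using t by (simp flip: cmod_power2)
      have "Re t = 0" using t1 t2 by (simp add: power2_eq_square algebra_simps)
      moreover from this have "Im t = 1 \<or> Im t = - 1" using t2 by (simp add: power2_eq_1_iff)
      ultimately have ti: "t = \<i> \<or> t = - \<i>" by (auto simp: complex_eq_iff)
      define F where "F z = \<phi> (\<Psi> z)" for z
      have ip: "\<phi> i * p = 1" using ia mult[of i a] \<phi>_1 by (simp add: p_def)
      have F_1: "F 1 = 1" using ia by (simp add: F_def \<Psi> \<phi>_1 flip: a_def)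
      have F_i: "F (B.emb \<i>) = t"
        using ip p0 unfolding F_def \<Psi> mult t_def by (simp add: field_simps flip: q_def)
      have F_ne: "F z \<noteq> 0" if "z \<in> GB" for z unfolding F_def by (intro \<phi>_ne \<Psi>_GB that)
      have F_lin: "bounded_linear F"
      proof (rule bounded_linear_intro)
        show "F (z + w) = F z + F w" for z w
          by (simp add: F_def \<Psi> linear_add[OF V(1)] distrib_left add)
        show "F (r *\<^sub>R z) = r *\<^sub>R F z" for r z
          by (simp add: F_def \<Psi> linear_scale[OF V(1)] \<phi>_scaleR)
        show "norm (F z) \<le> norm z * norm i" for z
        proof -
          have "cmod (F z) \<le> norm (i * V z)" unfolding F_def \<Psi> by (rule bound)
          also have "\<dots> \<le> norm i * norm (V z)" by (rule norm_mult_ineq)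
          finally show ?thesis by (simp add: V(3) mult.commute)
        qed
      qed
      have "F (x * y) = F x * F y"
        using ti
      proof
        assume "t = \<i>"
        then show ?thesis using B.real_linear_gleason_kahane_zelazko[OF GB F_lin F_1 _ F_ne] F_i by simp
      next
        assume "t = - \<i>"
        \<comment> \<open>Conjugation reduces this to the case where \<open>\<i>\<close> goes to
          \<open>\<i>\<close>.\<close>
        have "cnj (F (x * y)) = cnj (F x) * cnj (F y)"
        proof (rule B.real_linear_gleason_kahane_zelazko[OF GB])
          show "bounded_linear (\<lambda>z. cnj (F z))" by (rule bounded_linear_compose[OF bounded_linear_cnj F_lin])
        qed (use F_1 F_i F_ne \<open>t = - \<i>\<close> in auto)
        then show ?thesis by (metis complex_cnj_cnj complex_cnj_mult)
      qed
      then show False using ne by (simp add: F_def \<phi>_diff mult)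
    qed
  qed
  then show ?thesis unfolding semisimple by simp
qed

theorem theorem3p2:
  fixes csA :: "complex \<Rightarrow> 'a::{real_normed_algebra_1, banach} \<Rightarrow> 'a"
    and csB :: "complex \<Rightarrow> 'b::{real_normed_algebra_1, banach} \<Rightarrow> 'b"
    and GA :: "'a set" and GB :: "'b set" and T :: "'a \<Rightarrow> 'b"
  assumes "complex_normed_algebra_structure csA"
    and "complex_normed_algebra_structure csB"
    and "semisimple TYPE('a)"
    and "commutative_alg TYPE('a)"
    and "open_subgroup_of_invertibles GA"
    and "open_subgroup_of_invertibles GB"
    and "T ` GA = GB"
    and "\<forall>f\<in>GA. \<forall>g\<in>GA. norm (T f - T g) = norm (f - g)"
  shows "semisimple TYPE('b) \<and> commutative_alg TYPE('b) \<and>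
    (\<exists>\<Phi> :: 'a \<Rightarrow> 'b. linear \<Phi> \<and> bij \<Phi> \<and>
        (\<forall>x y. \<Phi> (x * y) = \<Phi> x * \<Phi> y) \<and>
        (\<forall>x. norm (\<Phi> x) = norm x) \<and>
        (\<forall>f\<in>GA. \<Phi> f = ring_inverse (T 1) * T f)) \<and>
    (\<exists>\<psi> :: 'a \<Rightarrow> 'b. bij_betw \<psi> invertibles invertibles \<and>
        (\<forall>x\<in>invertibles. \<forall>y\<in>invertibles. \<psi> (x * y) = \<psi> x * \<psi> y) \<and>
        (\<forall>x\<in>invertibles. \<forall>y\<in>invertibles. dist (\<psi> x) (\<psi> y) = dist x y))"
proof -
  note GA = assms(5) and GB = assms(6) and TG = assms(7)
  interpret A: complex_algebra csA by unfold_locales (rule assms(1))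
  interpret B: complex_algebra csB by unfold_locales (rule assms(2))
  have radA: "(jacobson_radical :: 'a set) = {0}" using assms(3) by (simp add: semisimple_def)
  have comm: "a * b = b * a" for a b :: 'a using assms(4) by (simp add: commutative_alg_def)
  have "open (T ` GA)" unfolding TG by (rule open_subgroup_open[OF GB])
  then obtain S u where S: "linear S" "surj S" "\<And>x. norm (S x) = norm x" and TS: "\<And>f. f \<in> GA \<Longrightarrow> T f = S f + u"
    using A.open_subgroup_isometry_affine[OF GA] assms(8) by metis
  have "inj S" unfolding linear_injective_0[OF S(1)] using S(3) by (metis norm_eq_zero)
  define V where "V = inv S"
  have SV: "S (V y) = y" for y unfolding V_def by (rule surj_f_inv_f[OF S(2)])
  have VS: "V (S x) = x" for x unfolding V_def by (rule inv_f_f[OF \<open>inj S\<close>])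
  have T_GB: "T f \<in> GB" if "f \<in> GA" for f using TG that by blast
  have radB: "(jacobson_radical :: 'b set) = {0}"
  proof (intro equalityI subsetI)
    fix w :: 'b assume w: "w \<in> jacobson_radical"
    have "V w \<in> jacobson_radical"
    proof (rule A.jacobson_radical_if_translates[OF GA])
      fix f assume f: "f \<in> GA"
      have "T f + w \<in> GB" by (rule open_subgroup_add_jacobson_radical[OF GB T_GB[OF f] w])
      then obtain g where g: "g \<in> GA" "T f + w = T g" using TG by blast
      then have "S g = S (f + V w)" using TS f by (simp add: linear_add[OF S(1)] SV)
      then show "f + V w \<in> GA" using g(1) \<open>inj S\<close> by (simp add: inj_eq)
    qed
    then have "V w = 0" unfolding radA by blast
    then show "w \<in> {0}" using SV[of w] linear_0[OF S(1)] by simp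
  next
    fix w :: 'b assume "w \<in> {0}"
    then show "w \<in> jacobson_radical"
      using left_ideal_jacobson_radical[where 'a = 'b] unfolding left_ideal_def by simp
  qed
  have "u \<in> jacobson_radical"
  proof (rule B.jacobson_radical_if_translates[OF GB])
    fix b assume "b \<in> GB"
    then obtain f where f: "f \<in> GA" "b = T f" using TG by blast
    have "A.emb (1 / 2) * f \<in> GA"
      by (intro open_subgroup_mult[OF GA] A.emb_in_open_subgroup[OF GA] f) simp
    moreover have "A.emb (1 / 2) * f = (1 / 2) *\<^sub>R f"
      using A.emb_of_real[of "1/2"] by (simp add: scaleR_conv_of_real)
    ultimately have h: "(1 / 2) *\<^sub>R f \<in> GA" by simp
    \<comment> \<open>Doubling \<open>T (f / 2) = S f / 2 + u\<close> counts \<open>u\<close> twice: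
      the result is \<open>T f + u\<close>.\<close>
    have "B.emb 2 * T ((1 / 2) *\<^sub>R f) \<in> GB"
      by (intro open_subgroup_mult[OF GB] B.emb_in_open_subgroup[OF GB] T_GB h) simp
    moreover have "B.emb 2 * T ((1 / 2) *\<^sub>R f) = 2 *\<^sub>R T ((1 / 2) *\<^sub>R f)"
      using B.emb_of_real[of 2] by (simp add: scaleR_conv_of_real)
    moreover have "2 *\<^sub>R T ((1 / 2) *\<^sub>R f) = b + u"
      unfolding TS[OF h] f(2) TS[OF f(1)] linear_scale[OF S(1)] by (simp add: scaleR_add_right scaleR_2)
    ultimately show "b + u \<in> GB" by simp
  qed
  then have "u = 0" unfolding radB by blast
  then have TS': "T f = S f" if "f \<in> GA" for f using TS[OF that] by simp
  have V_lin: "linear V"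
    by (rule linearI; rule injD[OF \<open>inj S\<close>]) (simp_all add: SV linear_add[OF S(1)] linear_scale[OF S(1)])
  have V_norm: "norm (V y) = norm y" for y using S(3)[of "V y"] by (simp add: SV)
  have V_GB: "V b \<in> GA" if "b \<in> GB" for b
  proof -
    obtain f where "f \<in> GA" "b = T f" using TG \<open>b \<in> GB\<close> by blast
    then show ?thesis using TS' VS by simp
  qed
  have "surj V" using VS by (metis surjI)
  define a where "a = V 1"
  define i where "i = ring_inverse a"
  have ai: "a \<in> invertibles"
    unfolding a_def by (intro open_subgroup_invertible[OF GA] V_GB open_subgroup_one[OF GB])
  have ia: "i * (a * x) = x" "a * (i * x) = x" for x
    unfolding i_def using ring_inverse_left_assoc[OF ai] ring_inverse_right_assoc[OF ai] by auto
  define \<Psi> where "\<Psi> y = i * V y" for y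
  define \<Phi> where "\<Phi> x = S (a * x)" for x
  have \<Psi>_mult: "\<Psi> (x * y) = \<Psi> x * \<Psi> y" for x y
    unfolding \<Psi>_def i_def a_def
    by (rule normalized_isometry_multiplicative[OF assms(1,2) comm radA GA GB V_lin \<open>surj V\<close> V_norm V_GB])
  have \<Psi>\<Phi>: "\<Psi> (\<Phi> x) = x" for x unfolding \<Psi>_def \<Phi>_def by (simp add: VS ia)
  have \<Phi>\<Psi>: "\<Phi> (\<Psi> y) = y" for y unfolding \<Psi>_def \<Phi>_def by (simp add: SV ia)
  have \<Phi>_mult: "\<Phi> (x * y) = \<Phi> x * \<Phi> y" for x y by (metis \<Psi>_mult \<Psi>\<Phi> \<Phi>\<Psi>)
  have commB: "x * y = y * x" for x y :: 'b by (metis \<Psi>_mult \<Phi>\<Psi> comm)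
  have \<Phi>_lin: "linear \<Phi>"
    by (rule linearI) (simp_all add: \<Phi>_def distrib_left linear_add[OF S(1)] linear_scale[OF S(1)])
  have \<Phi>_bij: "bij \<Phi>" using \<Psi>\<Phi> \<Phi>\<Psi> by (intro o_bij[of \<Psi>]) auto
  have \<Phi>_1: "\<Phi> 1 = 1" unfolding \<Phi>_def a_def by (simp add: SV)
  \<comment> \<open>Both sides have the same image under \<open>\<Psi>\<close>, namely
    \<open>i * x\<close>.\<close>
  have S_\<Phi>: "S x = S 1 * \<Phi> x" for x
  proof -
    have "\<Psi> (S x) = \<Psi> (S 1) * x" by (simp add: \<Psi>_def VS)
    then show ?thesis by (metis \<Psi>_mult \<Phi>\<Psi> \<Psi>\<Phi>)
  qed
  \<comment> \<open>One inequality comes from \<open>\<Phi> x = S (a * x)\<close> with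
    \<open>norm a = 1\<close>, the other from \<open>S x = S 1 * \<Phi> x\<close> with
    \<open>norm (S 1) = 1\<close>.\<close>
  have \<Phi>_norm: "norm (\<Phi> x) = norm x" for x
  proof (rule antisym)
    have "norm (\<Phi> x) \<le> norm a * norm x" unfolding \<Phi>_def S(3) by (rule norm_mult_ineq)
    then show "norm (\<Phi> x) \<le> norm x" by (simp add: a_def V_norm)
    have "norm x = norm (S 1 * \<Phi> x)" using S(3)[of x] S_\<Phi>[of x] by simp
    also have "\<dots> \<le> norm (S 1) * norm (\<Phi> x)" by (rule norm_mult_ineq)
    finally show "norm x \<le> norm (\<Phi> x)" by (simp add: S(3))
  qed
  have \<Phi>_T: "\<Phi> f = ring_inverse (T 1) * T f" if f: "f \<in> GA" for f
  proof -
    have "T 1 \<in> invertibles" by (intro open_subgroup_invertible[OF GB] T_GB open_subgroup_one[OF GA])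
    then have "ring_inverse (T 1) * (T 1 * \<Phi> f) = \<Phi> f" by (rule ring_inverse_left_assoc)
    then show ?thesis using S_\<Phi>[of f] TS'[OF f] TS'[OF open_subgroup_one[OF GA]] by simp
  qed
  have \<Psi>_1: "\<Psi> 1 = 1" using \<Psi>\<Phi>[of 1] by (simp add: \<Phi>_1)
  have \<Phi>_inv: "bij_betw \<Phi> invertibles invertibles"
  proof (rule bij_betw_byWitness[where f' = \<Psi>])
    have "\<Phi> x \<in> invertibles" if "x \<in> invertibles" for x
      using ring_inverse_right[OF that] ring_inverse_left[OF that]
      by (intro invertiblesI[of _ "\<Phi> (ring_inverse x)"]) (simp_all add: \<Phi>_1 flip: \<Phi>_mult)
    then show "\<Phi> ` invertibles \<subseteq> invertibles" by blast
    have "\<Psi> x \<in> invertibles" if "x \<in> invertibles" for x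
      using ring_inverse_right[OF that] ring_inverse_left[OF that]
      by (intro invertiblesI[of _ "\<Psi> (ring_inverse x)"]) (simp_all add: \<Psi>_1 flip: \<Psi>_mult)
    then show "\<Psi> ` invertibles \<subseteq> invertibles" by blast
  qed (simp_all add: \<Psi>\<Phi> \<Phi>\<Psi>)
  have \<Phi>_dist: "dist (\<Phi> x) (\<Phi> y) = dist x y" for x y
    using \<Phi>_norm[of "x - y"] by (simp add: dist_norm linear_diff[OF \<Phi>_lin])
  show ?thesis
    unfolding semisimple_def commutative_alg_def
    by (intro conjI exI[of _ \<Phi>] ballI allI radB commB \<Phi>_lin \<Phi>_bij \<Phi>_mult \<Phi>_norm \<Phi>_T \<Phi>_inv \<Phi>_dist)
qed

end
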